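(* Let $m\geq 3$. The algebra $T$ is isomorphic (as a $\mathbb{C}$-algebra) to \[ \bigoplus_{d=0}^{m}\Big(m-d-\big\lfloor\tfrac{m-d+1}{2}\big\rfloor+1\Big)\odot \mathbb{C}^{(d+1)\times(d+1)}, \] where $n\odot B$ denotes the direct sum of $n$ copies of the algebra $B$.
   Context: Let $m\geq 3$, $S=\{1,\ldots,2m+1\}$, $X$ the set of $m$-subsets of $S$, and $O_{m+1}$ the Odd graph on $X$ (adjacency = disjointness), with distance $\partial$ and diameter $m$. Let $x_0=\{1,\ldots,m\}$, $A_1$ the adjacency matrix, $E^*_i$ ($0\leq i\leq m$) the diagonal $X\times X$ matrix with $(y,y)$-entry $1$ iff $\partial(x_0,y)=i$, and $T$ the (Terwilliger) algebra of complex matrices generated by $A_1,E^*_0,\ldots,E^*_m$. *)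

theory Defs
  imports Complex_Main
begin

text \<open>Matrices indexed by the vertex set X are functions nat set => nat set => complex
 that vanish outside X x X.\<close>

type_synonym vmat = "nat set \<Rightarrow> nat set \<Rightarrow> complex"

definition odd_X :: "nat \<Rightarrow> nat set set" where
  "odd_X m = {A. A \<subseteq> {1..2*m+1} \<and> card A = m}"

definition odd_adj :: "nat \<Rightarrow> nat set \<Rightarrow> nat set \<Rightarrow> bool" where
  "odd_adj m x y \<longleftrightarrow> x \<in> odd_X m \<and> y \<in> odd_X m \<and> x \<inter> y = {}"

inductive walk :: "nat \<Rightarrow> nat \<Rightarrow> nat set \<Rightarrow> nat set \<Rightarrow> bool" for m where
  walk0: "x \<in> odd_X m \<Longrightarrow> walk m 0 x x"
| walkS: "odd_adj m x z \<Longrightarrow> walk m n z y \<Longrightarrow> walk m (Suc n) x y"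

definition odd_dist :: "nat \<Rightarrow> nat set \<Rightarrow> nat set \<Rightarrow> nat" where
  "odd_dist m x y = (LEAST n. walk m n x y)"

definition base_x0 :: "nat \<Rightarrow> nat set" where
  "base_x0 m = {1..m}"

definition A1 :: "nat \<Rightarrow> vmat" where
  "A1 m = (\<lambda>x y. if odd_adj m x y then 1 else 0)"

definition Estar :: "nat \<Rightarrow> nat \<Rightarrow> vmat" where
  "Estar m i = (\<lambda>x y. if x \<in> odd_X m \<and> y = x \<and> odd_dist m (base_x0 m) x = i then 1 else 0)"

definition vmat_mult :: "nat \<Rightarrow> vmat \<Rightarrow> vmat \<Rightarrow> vmat" where
  "vmat_mult m A B = (\<lambda>x y. \<Sum>z\<in>odd_X m. A x z * B z y)"

definition vmat_one :: "nat \<Rightarrow> vmat" where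
  "vmat_one m = (\<lambda>x y. if x \<in> odd_X m \<and> y = x then 1 else 0)"

inductive_set terwilliger :: "nat \<Rightarrow> vmat set" for m where
  gen_A: "A1 m \<in> terwilliger m"
| gen_E: "i \<le> m \<Longrightarrow> Estar m i \<in> terwilliger m"
| add: "A \<in> terwilliger m \<Longrightarrow> B \<in> terwilliger m \<Longrightarrow> (\<lambda>x y. A x y + B x y) \<in> terwilliger m"
| smult: "A \<in> terwilliger m \<Longrightarrow> (\<lambda>x y. c * A x y) \<in> terwilliger m"
| mult: "A \<in> terwilliger m \<Longrightarrow> B \<in> terwilliger m \<Longrightarrow> vmat_mult m A B \<in> terwilliger m"

text \<open>Target algebra: direct sum over d = 0..m of mult m d copies of the (d+1)x(d+1)
 complex matrices. An element is B with B d k i j the (i,j) entry of the k-th copy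
 in block d (zero outside the index range).\<close>

type_synonym dsum = "nat \<Rightarrow> nat \<Rightarrow> nat \<Rightarrow> nat \<Rightarrow> complex"

definition blk_mult :: "nat \<Rightarrow> nat \<Rightarrow> nat" where
  "blk_mult m d = m - d - (m - d + 1) div 2 + 1"

definition ds_carrier :: "nat \<Rightarrow> dsum set" where
  "ds_carrier m = {B. \<forall>d k i j. B d k i j \<noteq> 0 \<longrightarrow>
      d \<le> m \<and> k < blk_mult m d \<and> i \<le> d \<and> j \<le> d}"

definition ds_in :: "nat \<Rightarrow> nat \<Rightarrow> nat \<Rightarrow> nat \<Rightarrow> nat \<Rightarrow> bool" where
  "ds_in m d k i j \<longleftrightarrow> d \<le> m \<and> k < blk_mult m d \<and> i \<le> d \<and> j \<le> d"

definition ds_mult :: "nat \<Rightarrow> dsum \<Rightarrow> dsum \<Rightarrow> dsum" where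
  "ds_mult m B C = (\<lambda>d k i j. if ds_in m d k i j then (\<Sum>l\<le>d. B d k i l * C d k l j) else 0)"

definition ds_one :: "nat \<Rightarrow> dsum" where
  "ds_one m = (\<lambda>d k i j. if ds_in m d k i j \<and> i = j then 1 else 0)"

end

(* A vertex y splits into y inter x0 and y - x0. For p disjoint pairs inside x0 and q disjoint
   pairs outside x0, let v(y) be the product of [a in y] - [b in y] over the pairs (a,b), and let
   v_n be its restriction to the vertices at distance n from x0. Then v_n = 0 unless
   max(2p, 2q-1) <= n <= m, and A_1 acts on the span of the v_n by an irreducible tridiagonal
   matrix, which gives a block of size m - max(2p, 2q-1) + 1 for each (p,q). All blocks meet
   distance m, and the entries of E*_m A_1 E*_m and E*_m A_1 E*_(m-1) A_1 E*_m separate the labels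
   (p,q); interpolation and the tridiagonal action then produce every matrix unit, so T maps onto
   the direct sum. Injectivity is a dimension count: T is contained in the matrices that are
   constant on the orbits of Sym(x0) x Sym(S - x0) on X x X, and there are at most as many
   orbits as matrix units. *)
theory Submission
  imports Defs "HOL-Library.Function_Algebras" "HOL-Combinatorics.Permutations"
begin

section \<open>Products of pair differences\<close>

text \<open>The obstacle is to obtain a faithful action of T without decomposing C^X into
  irreducible modules. One string of vectors per label is used, and the orbit count stands in for
  completeness: intersection sizes, once shifted, satisfy the very inequalities that index the
  matrix units. Pair products suit \<open>A1\<close> because the neighbours of y are its complement
  minus one point. Complementation changes a pair product only by a sign, and summing over deletions
  of one point multiplies it by a scalar, since the two ends of a pair enter with opposite signs.
  The bound max(2p, 2q-1) arises because y and its complement must each contain one end of every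
  pair. With t points of y in x0 this says p <= t, p <= m - t, q <= m - t and q <= t + 1; the
  distance is min(2(m-t), 2t+1), so these are 2p <= n and 2q-1 <= n. Distance m is singled out
  because an edge joins vertices at equal distance from x0 only if that distance is m; only there
  does A_1 have a diagonal entry, and it sees one of p, q while the two-step entry sees the
  other.\<close>

definition pair_diff :: "'a \<Rightarrow> 'a \<Rightarrow> 'a set \<Rightarrow> complex" where
  "pair_diff a b B = of_bool (a \<in> B) - of_bool (b \<in> B)"

definition pair_prod :: "(nat \<Rightarrow> 'a) \<Rightarrow> (nat \<Rightarrow> 'a) \<Rightarrow> nat \<Rightarrow> 'a set \<Rightarrow> complex" where
  "pair_prod a b p B = (\<Prod>i<p. pair_diff (a i) (b i) B)"

definition disjoint_pairs :: "(nat \<Rightarrow> 'a) \<Rightarrow> (nat \<Rightarrow> 'a) \<Rightarrow> nat \<Rightarrow> bool" where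
  "disjoint_pairs a b p \<longleftrightarrow> (\<forall>i<p. \<forall>j<p. i \<noteq> j \<longrightarrow> {a i, b i} \<inter> {a j, b j} = {})"

lemma pair_prod_remove:
  assumes "\<And>i. i < p \<Longrightarrow> c \<noteq> a i \<and> c \<noteq> b i"
  shows "pair_prod a b p (B - {c}) = pair_prod a b p B"
  unfolding pair_prod_def pair_diff_def using assms by (intro prod.cong) auto

lemma pair_prod_compl:
  assumes "\<And>i. i < p \<Longrightarrow> a i \<in> S \<and> b i \<in> S"
  shows "pair_prod a b p (S - B) = (-1) ^ p * pair_prod a b p B"
proof -
  have "pair_prod a b p (S - B) = (\<Prod>i<p. - 1 * pair_diff (a i) (b i) B)"
    unfolding pair_prod_def pair_diff_def using assms by (intro prod.cong) auto
  then show ?thesis unfolding prod.distrib pair_prod_def by simp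
qed

text \<open>If the product is nonzero, \<open>B\<close> contains one end of each pair: deleting such
  an end kills a factor, deleting any other point changes nothing. If a factor vanishes because both
  ends lie in \<open>B\<close>, the two deletions cancel.\<close>

lemma sum_pair_prod_remove:
  assumes "finite (B \<inter> C)" and "disjoint_pairs a b p" and "\<And>i. i < p \<Longrightarrow> a i \<in> C \<and> b i \<in> C"
  shows "(\<Sum>c\<in>B \<inter> C. pair_prod a b p (B - {c})) =
    (of_nat (card (B \<inter> C)) - of_nat p) * pair_prod a b p B"
  using assms(2,3)
proof (induction p)
  case 0
  then show ?case by (simp add: pair_prod_def)
next
  case (Suc p)
  let ?F = "pair_prod a b p" and ?h = "pair_diff (a p) (b p)"
  have dp: "disjoint_pairs a b p" using Suc.prems(1) by (auto simp: disjoint_pairs_def)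
  have F: "pair_prod a b (Suc p) D = ?F D * ?h D" for D by (simp add: pair_prod_def)
  have rem: "?F (B - {a p}) = ?F B" "?F (B - {b p}) = ?F B"
    using Suc.prems(1) unfolding disjoint_pairs_def
    by (intro pair_prod_remove; fastforce simp: less_Suc_eq)+
  \<comment> \<open>Deleting \<open>a p\<close> lowers the last factor by 1 and deleting
    \<open>b p\<close> raises it by 1, while the other pairs see neither. The two corrections add up
    to \<open>- ?F B * ?h B\<close>, one unit of the scalar per pair.\<close>
  have h: "?h (B - {c}) = ?h B - of_bool (c = a p) + of_bool (c = b p)" if "c \<in> B" for c
    using that by (auto simp: pair_diff_def)
  have "(\<Sum>c\<in>B \<inter> C. pair_prod a b (Suc p) (B - {c}))
      = (\<Sum>c\<in>B \<inter> C. ?F (B - {c}) * ?h B - (if c = a p then ?F (B - {c}) else 0)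
          + (if c = b p then ?F (B - {c}) else 0))"
    by (intro sum.cong refl) (simp add: F h algebra_simps)
  also have "\<dots> = (\<Sum>c\<in>B \<inter> C. ?F (B - {c})) * ?h B
      - (if a p \<in> B then ?F B else 0) + (if b p \<in> B then ?F B else 0)"
    using Suc.prems(2)[of p] assms(1)
    by (simp add: sum.distrib sum_subtractf sum_distrib_right sum.delta rem)
  also have "\<dots> = (\<Sum>c\<in>B \<inter> C. ?F (B - {c})) * ?h B - ?F B * ?h B"
    by (simp add: pair_diff_def algebra_simps)
  finally show ?case using Suc.IH[OF dp] Suc.prems(2) by (simp add: F algebra_simps)
qed

text \<open>A nonzero factor means that exactly one end of its pair lies in \<open>B\<close>;
  disjointness makes the choice of this end injective.\<close>

lemma pair_prod_nonzero_card:
  assumes "pair_prod a b p B \<noteq> 0" and "finite (B \<inter> C)" and "disjoint_pairs a b p"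
    and "\<And>i. i < p \<Longrightarrow> a i \<in> C \<and> b i \<in> C"
  shows "p \<le> card (B \<inter> C)"
proof -
  let ?f = "\<lambda>i. if a i \<in> B then a i else b i"
  have nz: "pair_diff (a i) (b i) B \<noteq> 0" if "i < p" for i
    using assms(1) that by (auto simp: pair_prod_def)
  have "inj_on ?f {..<p}"
    using assms(3) unfolding disjoint_pairs_def by (intro inj_onI) (fastforce split: if_splits)
  moreover have "?f ` {..<p} \<subseteq> B \<inter> C"
    using nz assms(4) by (fastforce simp: pair_diff_def split: if_splits)
  ultimately have "card {..<p} \<le> card (B \<inter> C)"
    using assms(2) by (intro card_inj_on_le[of ?f]) auto
  then show ?thesis by simp
qed

section \<open>Levels and distances\<close>

definition ground :: "nat \<Rightarrow> nat set" where "ground m = {1..2*m+1}"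
definition outer :: "nat \<Rightarrow> nat set" where "outer m = {m+1..2*m+1}"
definition level :: "nat \<Rightarrow> nat set \<Rightarrow> nat" where "level m y = card (y \<inter> base_x0 m)"

text \<open>The distance from \<open>base_x0 m\<close> of a vertex with t points in it. Two steps
  exchange one point, which gives the even term; the odd term is one step to a vertex disjoint from
  \<open>base_x0 m\<close> followed by t exchanges.\<close>

definition level_dist :: "nat \<Rightarrow> nat \<Rightarrow> nat" where
  "level_dist m t = min (2 * (m - t)) (2 * t + 1)"

definition dist_level :: "nat \<Rightarrow> nat \<Rightarrow> nat" where
  "dist_level m n = (if even n then m - n div 2 else n div 2)"

text \<open>The two terms of the minimum add up to 2m + 1.\<close>

lemma level_dist_le: "t \<le> m \<Longrightarrow> level_dist m t \<le> m"
  unfolding level_dist_def min_def by (simp; linarith)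

lemma level_dist_level [simp]:
  assumes "n \<le> m"
  shows "level_dist m (dist_level m n) = n"
proof (cases "even n")
  case True
  then obtain k where "n = 2 * k" by (rule evenE)
  with assms show ?thesis by (simp add: level_dist_def dist_level_def)
next
  case False
  then obtain k where "n = 2 * k + 1" by (rule oddE)
  with assms show ?thesis by (simp add: level_dist_def dist_level_def)
qed

lemma dist_level_le: "n \<le> m \<Longrightarrow> dist_level m n \<le> m"
  unfolding dist_level_def by auto

lemma dist_level_dist:
  assumes "t \<le> m"
  shows "dist_level m (level_dist m t) = t"
  using assms unfolding level_dist_def dist_level_def min_def by simp

section \<open>Vertices, levels and neighbours\<close>

lemma finite_odd_X [simp]: "finite (odd_X m)"
  unfolding odd_X_def by (rule finite_subset[of _ "Pow {1..2*m+1}"]) auto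

lemma odd_X_iff: "y \<in> odd_X m \<longleftrightarrow> y \<subseteq> ground m \<and> card y = m"
  by (simp add: odd_X_def ground_def)

lemma finite_ground [simp]: "finite (ground m)" by (simp add: ground_def)

lemma odd_X_finite: "y \<in> odd_X m \<Longrightarrow> finite y"
  using finite_subset[OF _ finite_ground] by (auto simp: odd_X_iff)

lemma base_outer:
  "ground m = base_x0 m \<union> outer m" "base_x0 m \<inter> outer m = {}"
  "finite (base_x0 m)" "finite (outer m)" "card (base_x0 m) = m" "card (outer m) = m + 1"
  by (auto simp: ground_def base_x0_def outer_def)

lemma base_in_odd_X: "base_x0 m \<in> odd_X m"
  by (auto simp: odd_X_def base_x0_def)

lemma level_le: "level m y \<le> m"
  using card_mono[OF base_outer(3), of "y \<inter> base_x0 m" m] by (simp add: level_def base_outer)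

lemma card_outer:
  assumes "y \<in> odd_X m"
  shows "card (y \<inter> outer m) = m - level m y"
proof -
  have "y = (y \<inter> base_x0 m) \<union> (y \<inter> outer m)"
    using assms base_outer by (auto simp: odd_X_iff)
  then have "card y = card (y \<inter> base_x0 m) + card (y \<inter> outer m)"
    using base_outer[of m] by (metis Int_assoc Int_left_commute card_Un_disjoint finite_Int inf_bot_right)
  then show ?thesis using assms by (auto simp: odd_X_iff level_def)
qed

lemma card_compl_base:
  "card ((ground m - y) \<inter> base_x0 m) = m - level m y"
proof -
  have "(ground m - y) \<inter> base_x0 m = base_x0 m - (y \<inter> base_x0 m)" using base_outer by auto
  then show ?thesis using base_outer by (simp add: card_Diff_subset level_def)
qed

lemma card_compl_outer:
  assumes "y \<in> odd_X m"
  shows "card ((ground m - y) \<inter> outer m) = level m y + 1"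
proof -
  have "(ground m - y) \<inter> outer m = outer m - (y \<inter> outer m)" using base_outer by auto
  then show ?thesis using base_outer card_outer[OF assms] level_le[of m y]
    by (simp add: card_Diff_subset)
qed

text \<open>The complement of a vertex has m + 1 points, so a vertex inside it omits exactly one of
  them.\<close>

lemma neighbours:
  assumes "y \<in> odd_X m"
  shows "{z. odd_adj m y z} = (\<lambda>c. ground m - y - {c}) ` (ground m - y)"
proof -
  have fin: "finite y" using odd_X_finite[OF assms] .
  have c: "card (ground m - y) = m + 1"
    using assms fin by (simp add: odd_X_iff card_Diff_subset) (simp add: ground_def)
  show ?thesis
  proof (intro equalityI subsetI)
    fix z assume "z \<in> {z. odd_adj m y z}"
    then have z: "z \<subseteq> ground m - y" "card z = m" by (auto simp: odd_adj_def odd_X_iff)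
    have "finite z" using finite_subset[OF z(1)] by simp
    with z c have "card (ground m - y - z) = 1" by (simp add: card_Diff_subset)
    then obtain e where "ground m - y - z = {e}" by (auto simp: card_1_singleton_iff)
    then have "z = ground m - y - {e}" "e \<in> ground m - y" using z(1) by auto
    then show "z \<in> (\<lambda>c. ground m - y - {c}) ` (ground m - y)" by blast
  next
    fix z assume "z \<in> (\<lambda>c. ground m - y - {c}) ` (ground m - y)"
    then obtain e where e: "e \<in> ground m - y" "z = ground m - y - {e}" by blast
    then have "card z = m" using c by (simp add: card_Diff_singleton)
    moreover have "z \<subseteq> ground m" "y \<inter> z = {}" using e(2) by auto
    ultimately show "z \<in> {z. odd_adj m y z}" using assms by (simp add: odd_adj_def odd_X_iff)
  qed
qed

lemma A1_row_sum:
  assumes "y \<in> odd_X m"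
  shows "(\<Sum>z\<in>odd_X m. A1 m y z * g z) = (\<Sum>c\<in>ground m - y. g (ground m - y - {c}))"
proof -
  have "(\<Sum>z\<in>odd_X m. A1 m y z * g z) = (\<Sum>z\<in>{z. odd_adj m y z}. g z)"
    by (rule sum.mono_neutral_cong_right) (auto simp: A1_def odd_adj_def)
  also have "\<dots> = (\<Sum>c\<in>ground m - y. g (ground m - y - {c}))"
  proof -
    have "inj_on (\<lambda>c. ground m - y - {c}) (ground m - y)" by (rule inj_onI) blast
    then show ?thesis unfolding neighbours[OF assms] by (simp add: sum.reindex)
  qed
  finally show ?thesis .
qed

lemma level_remove_base:
  assumes "c \<in> (ground m - y) \<inter> base_x0 m"
  shows "level m (ground m - y - {c}) = m - level m y - 1"
proof -
  have "(ground m - y - {c}) \<inter> base_x0 m = (ground m - y) \<inter> base_x0 m - {c}" by auto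
  then show ?thesis using assms card_compl_base[of m y] by (simp add: level_def card_Diff_singleton)
qed

lemma level_remove_outer:
  assumes "c \<in> (ground m - y) \<inter> outer m"
  shows "level m (ground m - y - {c}) = m - level m y"
proof -
  have "(ground m - y - {c}) \<inter> base_x0 m = (ground m - y) \<inter> base_x0 m"
    using assms base_outer by auto
  then show ?thesis using card_compl_base[of m y] by (simp add: level_def)
qed

section \<open>Distances from the base vertex\<close>

lemma walk_snoc: "walk m n x y \<Longrightarrow> odd_adj m y z \<Longrightarrow> walk m (Suc n) x z"
proof (induction rule: walk.induct)
  case (walk0 x)
  then show ?case by (meson odd_adj_def walk.walk0 walk.walkS)
next
  case (walkS x z n y)
  then show ?case by (meson walk.walkS)
qed

lemma adj_level_cases:
  assumes "odd_adj m y z"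
  shows "level m z = m - level m y \<or> (level m y < m \<and> level m z = m - level m y - 1)"
proof -
  have y: "y \<in> odd_X m" using assms by (simp add: odd_adj_def)
  then obtain c where c: "c \<in> ground m - y" "z = ground m - y - {c}"
    using assms neighbours[OF y] by blast
  show ?thesis
  proof (cases "c \<in> base_x0 m")
    case True
    then have cb: "c \<in> (ground m - y) \<inter> base_x0 m" using c by auto
    moreover have "card ((ground m - y) \<inter> base_x0 m) > 0"
      using cb by (auto simp: card_gt_0_iff)
    ultimately show ?thesis using c(2) level_remove_base[OF cb] card_compl_base[of m y] by auto
  next
    case False
    then have "c \<in> (ground m - y) \<inter> outer m" using c base_outer(1) by auto
    from level_remove_outer[OF this] show ?thesis using c by simp
  qed
qed

text \<open>Either level available to a neighbour raises \<open>level_dist\<close> by at most 1.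
  This is the lower bound for the distance; \<open>exists_walk\<close> attains it.\<close>

lemma walk_level_dist: "walk m n x y \<Longrightarrow> level_dist m (level m y) \<le> n + level_dist m (level m x)"
proof (induction rule: walk.induct)
  case (walkS x z n y)
  have "level_dist m (level m z) \<le> Suc (level_dist m (level m x))"
    using adj_level_cases[OF walkS.hyps(1)] level_le[of m x] unfolding level_dist_def
    by (elim disjE conjE) simp_all
  then show ?case using walkS.IH by simp
qed simp

lemma exists_walk:
  "y \<in> odd_X m \<Longrightarrow> level_dist m (level m y) = n \<Longrightarrow> walk m n (base_x0 m) y"
proof (induction n arbitrary: y)
  case 0
  then have "level m y = m" using level_le[of m y] by (auto simp: level_dist_def)
  then have "y \<inter> base_x0 m = base_x0 m"
    using base_outer[of m] by (intro card_subset_eq) (auto simp: level_def)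
  then have "y = base_x0 m"
    using 0(1) base_outer odd_X_finite[OF 0(1)]
    by (metis card_subset_eq inf_le1 odd_X_iff)
  then show ?case using walk.walk0 base_in_odd_X by auto
next
  case (Suc n)
  have "\<exists>z. odd_adj m y z \<and> level_dist m (level m z) = n"
  \<comment> \<open>If the even term is the minimum, the neighbour omitting a point of
    \<open>base_x0 m\<close> is one step closer; otherwise the neighbour omitting an outer point
    is.\<close>
  proof (cases "2 * (m - level m y) = Suc n")
    case True
    then have "card ((ground m - y) \<inter> base_x0 m) > 0" by (simp add: card_compl_base)
    then obtain c where c: "c \<in> (ground m - y) \<inter> base_x0 m" by (auto simp: card_gt_0_iff)
    have "level_dist m (level m (ground m - y - {c})) = n"
      using True Suc.prems(2) level_le[of m y]
      unfolding level_remove_base[OF c] level_dist_def by simp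
    then show ?thesis using neighbours[OF Suc.prems(1)] c by blast
  next
    case False
    then have n: "Suc n = 2 * level m y + 1" using Suc.prems(2)
      by (auto simp: level_dist_def min_def split: if_splits)
    have "card ((ground m - y) \<inter> outer m) > 0" using card_compl_outer[OF Suc.prems(1)] by simp
    then obtain c where c: "c \<in> (ground m - y) \<inter> outer m" by (auto simp: card_gt_0_iff)
    have "level_dist m (level m (ground m - y - {c})) = n"
      using n False Suc.prems(2) level_le[of m y]
      unfolding level_remove_outer[OF c] level_dist_def by (simp add: min_def split: if_splits)
    then show ?thesis using neighbours[OF Suc.prems(1)] c by blast
  qed
  then obtain z where z: "odd_adj m y z" "level_dist m (level m z) = n" by blast
  then have "odd_adj m z y" "z \<in> odd_X m" by (auto simp: odd_adj_def)
  then show ?case using walk_snoc Suc.IH z by blast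
qed

lemma odd_dist_eq:
  assumes "y \<in> odd_X m"
  shows "odd_dist m (base_x0 m) y = level_dist m (level m y)"
  unfolding odd_dist_def
proof (rule Least_equality)
  show "walk m (level_dist m (level m y)) (base_x0 m) y" using exists_walk[OF assms] by simp
  have "level_dist m (level m (base_x0 m)) = 0" by (simp add: level_def base_outer level_dist_def)
  then show "level_dist m (level m y) \<le> n" if "walk m n (base_x0 m) y" for n
    using walk_level_dist[OF that] by simp
qed

section \<open>The modules\<close>

definition vdist :: "nat \<Rightarrow> nat set \<Rightarrow> nat" where
  "vdist m y = level_dist m (level m y)"

lemma vdist_le: "vdist m y \<le> m"
  by (simp add: vdist_def level_dist_le level_le)

lemma Estar_eq:
  "Estar m i = (\<lambda>x y. if x \<in> odd_X m \<and> y = x \<and> vdist m x = i then 1 else 0)"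
  unfolding Estar_def vdist_def using odd_dist_eq by (intro ext) auto

text \<open>Factors of this kind generate copies of two-row Specht modules. The pairs are nested
  from the ends of each part, so that the initial segments in \<open>test_vertex\<close> can contain
  all first ends and no second end.\<close>

definition specht :: "nat \<Rightarrow> nat \<Rightarrow> nat \<Rightarrow> nat set \<Rightarrow> complex" where
  "specht m p q B = pair_prod (\<lambda>i. 1 + i) (\<lambda>i. m - i) p B
     * pair_prod (\<lambda>j. m + 1 + j) (\<lambda>j. 2 * m + 1 - j) q B"

text \<open>The bounds express that p disjoint pairs fit into the m points of
  \<open>base_x0 m\<close> and q into the m + 1 points of \<open>outer m\<close>.\<close>

definition labels :: "nat \<Rightarrow> (nat \<times> nat) set" where
  "labels m = {(p, q). 2 * p \<le> m \<and> 2 * q \<le> m + 1}"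

text \<open>The smallest distance at which the vectors with label (p, q) are supported. For q = 0
  the truncated subtraction 2 * q - 1 is 0, as it should be.\<close>
definition endpoint :: "nat \<Rightarrow> nat \<Rightarrow> nat" where
  "endpoint p q = max (2 * p) (2 * q - 1)"

lemma finite_labels [simp]: "finite (labels m)"
  by (rule finite_subset[of _ "{..m} \<times> {..m+1}"]) (auto simp: labels_def)

lemma endpoint_le: "(p, q) \<in> labels m \<Longrightarrow> endpoint p q \<le> m"
  by (auto simp: labels_def endpoint_def)

lemma label_pairs:
  assumes "(p, q) \<in> labels m"
  shows "disjoint_pairs (\<lambda>i. 1 + i) (\<lambda>i. m - i) p"
    "disjoint_pairs (\<lambda>j. m + 1 + j) (\<lambda>j. 2 * m + 1 - j) q"
    "\<And>i. i < p \<Longrightarrow> 1 + i \<in> base_x0 m \<and> m - i \<in> base_x0 m"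
    "\<And>j. j < q \<Longrightarrow> m + 1 + j \<in> outer m \<and> 2 * m + 1 - j \<in> outer m"
  using assms by (auto simp: labels_def disjoint_pairs_def base_x0_def outer_def)

lemma specht_compl:
  assumes "(p, q) \<in> labels m"
  shows "specht m p q (ground m - B) = (-1) ^ (p + q) * specht m p q B"
proof -
  have "pair_prod (\<lambda>i. 1 + i) (\<lambda>i. m - i) p (ground m - B)
      = (-1) ^ p * pair_prod (\<lambda>i. 1 + i) (\<lambda>i. m - i) p B"
    using label_pairs(3)[OF assms] base_outer(1) by (intro pair_prod_compl) blast
  moreover have "pair_prod (\<lambda>j. m + 1 + j) (\<lambda>j. 2 * m + 1 - j) q (ground m - B)
      = (-1) ^ q * pair_prod (\<lambda>j. m + 1 + j) (\<lambda>j. 2 * m + 1 - j) q B"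
    using label_pairs(4)[OF assms] base_outer(1) by (intro pair_prod_compl) blast
  ultimately show ?thesis by (simp add: specht_def power_add)
qed

lemma specht_nonzero:
  assumes "(p, q) \<in> labels m" and "specht m p q B \<noteq> 0"
  shows "p \<le> card (B \<inter> base_x0 m)" "q \<le> card (B \<inter> outer m)"
  using assms(2) label_pairs[OF assms(1)] base_outer(3,4)
  by (auto simp: specht_def intro!: pair_prod_nonzero_card)

lemma specht_support:
  assumes "(p, q) \<in> labels m" and "y \<in> odd_X m" and "specht m p q y \<noteq> 0"
  shows "endpoint p q \<le> vdist m y"
proof -
  have "specht m p q (ground m - y) \<noteq> 0" using assms specht_compl by simp
  then show ?thesis
    using specht_nonzero[OF assms(1,3)] specht_nonzero[OF assms(1), of "ground m - y"]
      card_outer[OF assms(2)] card_compl_base[of m y] card_compl_outer[OF assms(2)]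
    by (auto simp: endpoint_def vdist_def level_dist_def level_def[symmetric])
qed

text \<open>An arbitrary function \<open>f\<close> of the distance treats all restrictions to a
  fixed distance at once. The sign comes from passing to the complement of \<open>y\<close>; an
  omitted point affects only the factor of its own part, where \<open>sum_pair_prod_remove\<close>
  applies. For t = m the truncated \<open>m - t - 1\<close> is harmless, as the sum over omitted
  points of \<open>base_x0 m\<close> is then empty.\<close>

lemma A1_specht:
  assumes "(p, q) \<in> labels m" and y: "y \<in> odd_X m"
  defines "t \<equiv> level m y"
  shows "(\<Sum>z\<in>odd_X m. A1 m y z * (f (vdist m z) * specht m p q z)) =
    (-1) ^ (p + q) * ((of_nat m - of_nat t - of_nat p) * f (level_dist m (m - t - 1))
      + (of_nat t + 1 - of_nat q) * f (level_dist m (m - t))) * specht m p q y"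
proof -
  define B where "B = ground m - y"
  define F where "F = pair_prod (\<lambda>i. 1 + i) (\<lambda>i. m - i) p"
  define G where "G = pair_prod (\<lambda>j. m + 1 + j) (\<lambda>j. 2 * m + 1 - j) q"
  have FG: "specht m p q D = F D * G D" for D by (simp only: specht_def F_def G_def)
  let ?g = "\<lambda>c. f (vdist m (B - {c})) * specht m p q (B - {c})"
  have B: "B = (B \<inter> base_x0 m) \<union> (B \<inter> outer m)" using base_outer(1) by (auto simp: B_def)
  have G: "G (B - {c}) = G B" if "c \<in> base_x0 m" for c
    unfolding G_def using that label_pairs(4)[OF assms(1)] base_outer(2)
    by (intro pair_prod_remove) blast
  have F: "F (B - {c}) = F B" if "c \<in> outer m" for c
    unfolding F_def using that label_pairs(3)[OF assms(1)] base_outer(2)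
    by (intro pair_prod_remove) blast
  have tm: "t \<le> m" by (simp add: t_def level_le)
  have "(\<Sum>z\<in>odd_X m. A1 m y z * (f (vdist m z) * specht m p q z)) = (\<Sum>c\<in>B. ?g c)"
    unfolding A1_row_sum[OF y] B_def ..
  also have "\<dots> = (\<Sum>c\<in>B \<inter> base_x0 m. ?g c) + (\<Sum>c\<in>B \<inter> outer m. ?g c)"
    using base_outer(2-4) by (subst B) (intro sum.union_disjoint, auto)
  also have "(\<Sum>c\<in>B \<inter> base_x0 m. ?g c)
      = f (level_dist m (m - t - 1)) * (G B * (\<Sum>c\<in>B \<inter> base_x0 m. F (B - {c})))"
    unfolding sum_distrib_left
  proof (intro sum.cong refl)
    fix c assume c: "c \<in> B \<inter> base_x0 m"
    then have "vdist m (B - {c}) = level_dist m (m - t - 1)"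
      using level_remove_base[of c m y] by (simp add: vdist_def B_def t_def)
    then show "?g c = f (level_dist m (m - t - 1)) * (G B * F (B - {c}))"
      using c by (simp add: FG G)
  qed
  also have "(\<Sum>c\<in>B \<inter> outer m. ?g c)
      = f (level_dist m (m - t)) * (F B * (\<Sum>c\<in>B \<inter> outer m. G (B - {c})))"
    unfolding sum_distrib_left
  proof (intro sum.cong refl)
    fix c assume c: "c \<in> B \<inter> outer m"
    then have "vdist m (B - {c}) = level_dist m (m - t)"
      using level_remove_outer[of c m y] by (simp add: vdist_def B_def t_def)
    then show "?g c = f (level_dist m (m - t)) * (F B * G (B - {c}))"
      using c by (simp add: FG F)
  qed
  also have "(\<Sum>c\<in>B \<inter> base_x0 m. F (B - {c})) = (of_nat (card (B \<inter> base_x0 m)) - of_nat p) * F B"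
    unfolding F_def using base_outer(3)
    by (intro sum_pair_prod_remove label_pairs(1)[OF assms(1)] label_pairs(3)[OF assms(1)]) simp_all
  also have "of_nat (card (B \<inter> base_x0 m)) = complex_of_nat m - of_nat t"
    using card_compl_base[of m y] tm by (simp add: B_def t_def of_nat_diff)
  also have "(\<Sum>c\<in>B \<inter> outer m. G (B - {c})) = (of_nat (card (B \<inter> outer m)) - of_nat q) * G B"
    unfolding G_def using base_outer(4)
    by (intro sum_pair_prod_remove label_pairs(2)[OF assms(1)] label_pairs(4)[OF assms(1)]) simp_all
  also have "of_nat (card (B \<inter> outer m)) = complex_of_nat t + 1"
    using card_compl_outer[OF y] by (simp add: B_def t_def)
  finally have "(\<Sum>z\<in>odd_X m. A1 m y z * (f (vdist m z) * specht m p q z)) =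
      ((of_nat m - of_nat t - of_nat p) * f (level_dist m (m - t - 1))
        + (of_nat t + 1 - of_nat q) * f (level_dist m (m - t))) * specht m p q B"
    by (simp add: FG algebra_simps)
  then show ?thesis by (simp add: B_def specht_compl[OF assms(1)])
qed

definition test_vertex :: "nat \<Rightarrow> nat \<Rightarrow> nat set" where
  "test_vertex m n = {1..dist_level m n} \<union> {m+1..2 * m - dist_level m n}"

lemma test_vertex:
  assumes "n \<le> m"
  shows "test_vertex m n \<in> odd_X m" "level m (test_vertex m n) = dist_level m n"
    "vdist m (test_vertex m n) = n"
proof -
  define t where "t = dist_level m n"
  have t: "t \<le> m" using dist_level_le[OF assms] by (simp add: t_def)
  have "card ({1..t} \<union> {m+1..2 * m - t}) = card {1..t} + card {m+1..2 * m - t}"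
    using t by (intro card_Un_disjoint) auto
  then show "test_vertex m n \<in> odd_X m"
    using t by (auto simp: test_vertex_def odd_X_def t_def[symmetric])
  have "({1..t} \<union> {m+1..2 * m - t}) \<inter> {1..m} = {1..t}" using t by auto
  then show l: "level m (test_vertex m n) = dist_level m n"
    by (simp add: level_def test_vertex_def t_def[symmetric] base_x0_def)
  show "vdist m (test_vertex m n) = n" using assms by (simp add: vdist_def l)
qed

text \<open>With t the level of the vertex and n at least the endpoint,
  \<open>1 + i <= t < m - i\<close> holds for each pair in \<open>base_x0 m\<close>, and similarly
  outside, so every factor is 1.\<close>

lemma specht_test_vertex:
  assumes "(p, q) \<in> labels m" and "n \<le> m"
  shows "specht m p q (test_vertex m n) = of_bool (endpoint p q \<le> n)"
proof (cases "endpoint p q \<le> n")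
  case True
  define t where "t = dist_level m n"
  have t: "t \<le> m" "level_dist m t = n" using assms(2) by (simp_all add: t_def dist_level_le)
  then have pq: "2 * p \<le> 2 * (m - t)" "2 * p \<le> 2 * t + 1" "2 * q - 1 \<le> 2 * (m - t)" "2 * q - 1 \<le> 2 * t + 1"
    using True by (auto simp: level_dist_def endpoint_def)
  have "pair_prod (\<lambda>i. 1 + i) (\<lambda>i. m - i) p (test_vertex m n) = 1"
    unfolding pair_prod_def
  proof (intro prod.neutral ballI)
    fix i assume "i \<in> {..<p}"
    then show "pair_diff (1 + i) (m - i) (test_vertex m n) = 1"
      using pq t by (auto simp: pair_diff_def test_vertex_def t_def[symmetric])
  qed
  moreover have "pair_prod (\<lambda>j. m + 1 + j) (\<lambda>j. 2 * m + 1 - j) q (test_vertex m n) = 1"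
    unfolding pair_prod_def
  proof (intro prod.neutral ballI)
    fix j assume "j \<in> {..<q}"
    then show "pair_diff (m + 1 + j) (2 * m + 1 - j) (test_vertex m n) = 1"
      using pq t by (auto simp: pair_diff_def test_vertex_def t_def[symmetric])
  qed
  ultimately show ?thesis using True by (simp add: specht_def)
next
  case False
  then show ?thesis using specht_support[OF assms(1) test_vertex(1)[OF assms(2)]]
    test_vertex(3)[OF assms(2)] by auto
qed

section \<open>Matrix coefficients of the action\<close>

definition module_vec :: "nat \<Rightarrow> nat \<times> nat \<Rightarrow> nat \<Rightarrow> nat set \<Rightarrow> complex" where
  "module_vec m l n y = of_bool (vdist m y = n) * specht m (fst l) (snd l) y"

text \<open>Since the vectors of a module take the value 1 at the test vertices, the coefficients of the
  action of M are read off by evaluation.\<close>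
definition rep :: "nat \<Rightarrow> nat \<times> nat \<Rightarrow> vmat \<Rightarrow> nat \<Rightarrow> nat \<Rightarrow> complex" where
  "rep m l M i j = (\<Sum>z\<in>odd_X m. M (test_vertex m i) z * module_vec m l j z)"

definition label_endpoint :: "nat \<times> nat \<Rightarrow> nat" where
  "label_endpoint l = endpoint (fst l) (snd l)"

lemma rep_add: "rep m l (\<lambda>x y. M x y + N x y) i j = rep m l M i j + rep m l N i j"
  by (simp add: rep_def distrib_right sum.distrib)

lemma rep_smult: "rep m l (\<lambda>x y. c * M x y) i j = c * rep m l M i j"
  by (simp add: rep_def sum_distrib_left mult.assoc)

lemma A1_module_vec:
  assumes "l \<in> labels m" and y: "y \<in> odd_X m"
  shows "(\<Sum>z\<in>odd_X m. A1 m y z * module_vec m l j z) =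
    (-1) ^ (fst l + snd l)
      * ((of_nat m - of_nat (level m y) - of_nat (fst l)) * of_bool (level_dist m (m - level m y - 1) = j)
      + (of_nat (level m y) + 1 - of_nat (snd l)) * of_bool (level_dist m (m - level m y) = j))
      * specht m (fst l) (snd l) y"
  using A1_specht[of "fst l" "snd l" m y "\<lambda>n. of_bool (n = j)"] assms
  by (simp add: module_vec_def)

lemma sum_vdist:
  "(\<Sum>n\<le>m. f n * module_vec m l n z) = f (vdist m z) * specht m (fst l) (snd l) z"
proof -
  have "(\<Sum>n\<le>m. f n * module_vec m l n z)
      = (\<Sum>n\<le>m. if vdist m z = n then f n * specht m (fst l) (snd l) z else 0)"
    by (intro sum.cong) (auto simp: module_vec_def)
  then show ?thesis by (simp add: vdist_le)
qed

text \<open>Having coefficients that depend on \<open>y\<close> only through its distance survives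
  sums, multiples and products. \<open>K\<close> stays existential because its rows below the
  endpoint are unconstrained; \<open>rep_action\<close> pins down the others.\<close>

lemma terwilliger_module:
  assumes "M \<in> terwilliger m" and "l \<in> labels m"
  shows "\<exists>K. \<forall>y\<in>odd_X m. \<forall>j. (\<Sum>z\<in>odd_X m. M y z * module_vec m l j z)
    = K (vdist m y) j * specht m (fst l) (snd l) y"
  using assms(1)
proof induction
  case gen_A
  show ?case
    by (rule exI[of _ "\<lambda>n j. (-1) ^ (fst l + snd l)
      * ((of_nat m - of_nat (dist_level m n) - of_nat (fst l)) * of_bool (level_dist m (m - dist_level m n - 1) = j)
      + (of_nat (dist_level m n) + 1 - of_nat (snd l)) * of_bool (level_dist m (m - dist_level m n) = j))"])
      (simp add: A1_module_vec[OF assms(2)] vdist_def dist_level_dist level_le)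
next
  case (gen_E i)
  have "(\<Sum>z\<in>odd_X m. Estar m i y z * module_vec m l j z)
      = of_bool (vdist m y = i \<and> vdist m y = j) * specht m (fst l) (snd l) y" if "y \<in> odd_X m" for y j
  proof -
    have "(\<Sum>z\<in>odd_X m. Estar m i y z * module_vec m l j z)
        = (\<Sum>z\<in>odd_X m. if z = y then of_bool (vdist m y = i) * module_vec m l j y else 0)"
      using that by (intro sum.cong) (auto simp: Estar_eq)
    then show ?thesis using that by (simp add: module_vec_def)
  qed
  then show ?case by (intro exI[of _ "\<lambda>n j. of_bool (n = i \<and> n = j)"]) simp
next
  case (add A B)
  then obtain K L where "\<forall>y\<in>odd_X m. \<forall>j. (\<Sum>z\<in>odd_X m. A y z * module_vec m l j z)
      = K (vdist m y) j * specht m (fst l) (snd l) y"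
    "\<forall>y\<in>odd_X m. \<forall>j. (\<Sum>z\<in>odd_X m. B y z * module_vec m l j z)
      = L (vdist m y) j * specht m (fst l) (snd l) y" by blast
  then show ?case
    by (intro exI[of _ "\<lambda>n j. K n j + L n j"]) (simp add: distrib_right sum.distrib)
next
  case (smult A c)
  then obtain K where "\<forall>y\<in>odd_X m. \<forall>j. (\<Sum>z\<in>odd_X m. A y z * module_vec m l j z)
      = K (vdist m y) j * specht m (fst l) (snd l) y" by blast
  then show ?case
    by (intro exI[of _ "\<lambda>n j. c * K n j"]) (simp add: mult.assoc sum_distrib_left[symmetric])
next
  case (mult A B)
  then obtain K L where K: "\<forall>y\<in>odd_X m. \<forall>j. (\<Sum>z\<in>odd_X m. A y z * module_vec m l j z)
      = K (vdist m y) j * specht m (fst l) (snd l) y"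
    and L: "\<forall>y\<in>odd_X m. \<forall>j. (\<Sum>z\<in>odd_X m. B y z * module_vec m l j z)
      = L (vdist m y) j * specht m (fst l) (snd l) y" by blast
  have "(\<Sum>z\<in>odd_X m. vmat_mult m A B y z * module_vec m l j z)
      = (\<Sum>n\<le>m. K (vdist m y) n * L n j) * specht m (fst l) (snd l) y" if y: "y \<in> odd_X m" for y j
  proof -
    have "(\<Sum>z\<in>odd_X m. vmat_mult m A B y z * module_vec m l j z)
        = (\<Sum>w\<in>odd_X m. A y w * (\<Sum>z\<in>odd_X m. B w z * module_vec m l j z))"
      unfolding vmat_mult_def sum_distrib_right sum_distrib_left
      by (subst sum.swap) (simp add: mult.assoc)
    also have "\<dots> = (\<Sum>w\<in>odd_X m. A y w * (\<Sum>n\<le>m. L n j * module_vec m l n w))"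
      using L by (simp add: sum_vdist)
    also have "\<dots> = (\<Sum>n\<le>m. L n j * (\<Sum>w\<in>odd_X m. A y w * module_vec m l n w))"
      unfolding sum_distrib_left by (subst sum.swap) (simp add: algebra_simps)
    finally show ?thesis using K y by (simp add: sum_distrib_left sum_distrib_right mult_ac)
  qed
  then show ?case by (intro exI[of _ "\<lambda>n j. \<Sum>k\<le>m. K n k * L k j"]) simp
qed

text \<open>Evaluation at the test vertex at the same distance as \<open>y\<close> identifies
  \<open>K\<close> with \<open>rep\<close>: the value there is 1 as soon as \<open>specht\<close> is
  nonzero at \<open>y\<close>.\<close>

lemma rep_action:
  assumes "M \<in> terwilliger m" and l: "l \<in> labels m" and y: "y \<in> odd_X m"
  shows "(\<Sum>z\<in>odd_X m. M y z * module_vec m l j z)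
    = rep m l M (vdist m y) j * specht m (fst l) (snd l) y"
proof (cases "specht m (fst l) (snd l) y = 0")
  case True
  then show ?thesis using terwilliger_module[OF assms(1,2)] y by auto
next
  case False
  have l': "(fst l, snd l) \<in> labels m" using l by simp
  from terwilliger_module[OF assms(1,2)] obtain K where
    K: "\<And>y j. y \<in> odd_X m \<Longrightarrow> (\<Sum>z\<in>odd_X m. M y z * module_vec m l j z)
      = K (vdist m y) j * specht m (fst l) (snd l) y" by blast
  have "rep m l M (vdist m y) j = K (vdist m y) j"
    unfolding rep_def using K[OF test_vertex(1)[OF vdist_le]]
      specht_test_vertex[OF l' vdist_le] specht_support[OF l' y False]
    by (simp add: test_vertex(3) vdist_le)
  then show ?thesis using K[OF y] by simp
qed

lemma rep_mult:
  assumes "N \<in> terwilliger m" and "l \<in> labels m"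
  shows "rep m l (vmat_mult m M N) i j = (\<Sum>n\<le>m. rep m l M i n * rep m l N n j)"
proof -
  let ?y = "test_vertex m i"
  have "rep m l (vmat_mult m M N) i j
      = (\<Sum>w\<in>odd_X m. M ?y w * (\<Sum>z\<in>odd_X m. N w z * module_vec m l j z))"
    unfolding rep_def vmat_mult_def sum_distrib_right sum_distrib_left
    by (subst sum.swap) (simp add: mult.assoc)
  also have "\<dots> = (\<Sum>w\<in>odd_X m. M ?y w * (\<Sum>n\<le>m. rep m l N n j * module_vec m l n w))"
    using assms by (simp add: rep_action sum_vdist)
  also have "\<dots> = (\<Sum>n\<le>m. rep m l N n j * (\<Sum>w\<in>odd_X m. M ?y w * module_vec m l n w))"
    unfolding sum_distrib_left by (subst sum.swap) (simp add: algebra_simps)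
  finally show ?thesis by (simp add: rep_def mult.commute)
qed

lemma module_vec_zero:
  assumes "l \<in> labels m" and "z \<in> odd_X m" and "j < label_endpoint l"
  shows "module_vec m l j z = 0"
  using specht_support[of "fst l" "snd l" m z] assms
  by (cases "specht m (fst l) (snd l) z = 0") (auto simp: module_vec_def label_endpoint_def)

text \<open>\<open>rep\<close> is kept as a matrix on 0..m for every label. Its columns, and by
  \<open>rep_zero_row\<close> its rows, below the endpoint vanish, which leaves the block of the
  module.\<close>

lemma rep_zero:
  assumes "l \<in> labels m" and "j < label_endpoint l"
  shows "rep m l M i j = 0"
  using assms module_vec_zero by (simp add: rep_def)

lemma rep_zero_row:
  assumes "M \<in> terwilliger m" and "l \<in> labels m" and "i < label_endpoint l" and "i \<le> m"
  shows "rep m l M i j = 0"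
  using rep_action[OF assms(1,2) test_vertex(1)[OF assms(4)], of j]
    specht_test_vertex[of "fst l" "snd l" m i] assms
  by (simp add: rep_def label_endpoint_def)

lemma rep_A1:
  assumes "l \<in> labels m" and "i \<le> m" and "label_endpoint l \<le> i" 
  defines "t \<equiv> dist_level m i"
  shows "rep m l (A1 m) i j = (-1) ^ (fst l + snd l)
      * ((of_nat m - of_nat t - of_nat (fst l)) * of_bool (level_dist m (m - t - 1) = j)
      + (of_nat t + 1 - of_nat (snd l)) * of_bool (level_dist m (m - t) = j))"
  unfolding rep_def t_def
  using assms specht_test_vertex[of "fst l" "snd l" m i]
  by (subst A1_module_vec) (auto simp: test_vertex label_endpoint_def)

lemma rep_Estar:
  assumes "l \<in> labels m" and "i \<le> m"
  shows "rep m l (Estar m k) i j = of_bool (i = k \<and> j = k \<and> label_endpoint l \<le> k)"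
proof -
  have "rep m l (Estar m k) i j = (\<Sum>z\<in>odd_X m. if z = test_vertex m i
      then of_bool (i = k) * module_vec m l j (test_vertex m i) else 0)"
    unfolding rep_def using assms by (intro sum.cong) (auto simp: Estar_eq test_vertex)
  then show ?thesis using assms specht_test_vertex[of "fst l" "snd l" m i]
    by (auto simp: module_vec_def test_vertex label_endpoint_def)
qed


section \<open>Matrix units\<close>

text \<open>On every module, \<open>M\<close> is a scalar multiple of the same matrix unit. For a =
  b such elements multiply like functions on the labels, which makes interpolation possible.\<close>

definition acts_as :: "nat \<Rightarrow> vmat \<Rightarrow> nat \<Rightarrow> nat \<Rightarrow> (nat \<times> nat \<Rightarrow> complex) \<Rightarrow> bool" where
  "acts_as m M a b c \<longleftrightarrow> M \<in> terwilliger m \<and>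
    (\<forall>l\<in>labels m. \<forall>i\<le>m. \<forall>j. rep m l M i j = (if i = a \<and> j = b then c l else 0))"

lemma acts_as_mult:
  assumes "acts_as m M a b c" and "acts_as m N b d e" and "b \<le> m"
  shows "acts_as m (vmat_mult m M N) a d (\<lambda>l. c l * e l)"
  unfolding acts_as_def
proof (intro conjI ballI allI impI)
  show "vmat_mult m M N \<in> terwilliger m"
    using assms by (simp add: acts_as_def terwilliger.mult)
  fix l i j assume l: "l \<in> labels m" and i: "i \<le> m"
  have "rep m l (vmat_mult m M N) i j = (\<Sum>n\<le>m. rep m l M i n * rep m l N n j)"
    using assms l by (simp add: rep_mult acts_as_def)
  also have "\<dots> = (\<Sum>n\<le>m. if n = b then if i = a \<and> j = d then c l * e l else 0 else 0)"
    using assms l i by (intro sum.cong) (auto simp: acts_as_def)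
  finally show "rep m l (vmat_mult m M N) i j = (if i = a \<and> j = d then c l * e l else 0)"
    using assms(3) by simp
qed

lemma acts_as_add:
  "acts_as m M a b c \<Longrightarrow> acts_as m N a b e \<Longrightarrow> acts_as m (\<lambda>x y. M x y + N x y) a b (\<lambda>l. c l + e l)"
  by (simp add: acts_as_def terwilliger.add rep_add)

lemma acts_as_smult:
  "acts_as m M a b c \<Longrightarrow> acts_as m (\<lambda>x y. k * M x y) a b (\<lambda>l. k * c l)"
  by (simp add: acts_as_def terwilliger.smult rep_smult)

lemma acts_as_Estar: "k \<le> m \<Longrightarrow> acts_as m (Estar m k) k k (\<lambda>l. of_bool (label_endpoint l \<le> k))"
  by (simp add: acts_as_def terwilliger.gen_E rep_Estar)

text \<open>Sandwiching between two \<open>Estar\<close> isolates one entry in all modules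
  simultaneously; where the endpoint exceeds a or b this entry is already 0.\<close>

lemma acts_as_corner:
  assumes "M \<in> terwilliger m" and "a \<le> m" and "b \<le> m"
  shows "acts_as m (vmat_mult m (Estar m a) (vmat_mult m M (Estar m b))) a b (\<lambda>l. rep m l M a b)"
  unfolding acts_as_def
proof (intro conjI ballI allI impI)
  have E: "Estar m a \<in> terwilliger m" "Estar m b \<in> terwilliger m"
    using assms by (simp_all add: terwilliger.gen_E)
  then have ME: "vmat_mult m M (Estar m b) \<in> terwilliger m" using assms by (simp add: terwilliger.mult)
  then show "vmat_mult m (Estar m a) (vmat_mult m M (Estar m b)) \<in> terwilliger m"
    using E by (simp add: terwilliger.mult)
  fix l i j assume l: "l \<in> labels m" and i: "i \<le> m"
  have r: "rep m l (vmat_mult m M (Estar m b)) n j = of_bool (j = b) * rep m l M n b"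
    if "n \<le> m" for n
  proof -
    have "rep m l (vmat_mult m M (Estar m b)) n j
        = (\<Sum>k\<le>m. rep m l M n k * of_bool (k = b \<and> j = b \<and> label_endpoint l \<le> b))"
      using E l by (simp add: rep_mult rep_Estar)
    also have "\<dots> = (\<Sum>k\<le>m. if k = b then of_bool (j = b) * rep m l M n b else 0)"
      using rep_zero[OF l, of b M n] by (intro sum.cong) (auto simp: not_le)
    finally show ?thesis using assms(3) by simp
  qed
  have "rep m l (vmat_mult m (Estar m a) (vmat_mult m M (Estar m b))) i j
      = (\<Sum>n\<le>m. of_bool (i = a \<and> n = a \<and> label_endpoint l \<le> a) * (of_bool (j = b) * rep m l M n b))"
    using ME l i by (simp add: rep_mult rep_Estar r)
  also have "\<dots> = (\<Sum>n\<le>m. if n = a then of_bool (i = a \<and> j = b) * rep m l M a b else 0)"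
    using rep_zero_row[OF assms(1) l, of a b] assms(2) by (intro sum.cong) (auto simp: not_le)
  finally show "rep m l (vmat_mult m (Estar m a) (vmat_mult m M (Estar m b))) i j
      = (if i = a \<and> j = b then rep m l M a b else 0)"
    using assms(2) by simp
qed

section \<open>Off-diagonal entries of the tridiagonal action\<close>

lemma label_endpoint_le: "l \<in> labels m \<Longrightarrow> label_endpoint l \<le> m"
  using endpoint_le[of "fst l" "snd l" m] by (simp add: label_endpoint_def)

text \<open>Up to sign the entry is t + 1 - q for even n and m - t - p for odd n, where t is the
  level at distance n; both are positive once n reaches the endpoint.\<close>

lemma rep_A1_up_nonzero:
  assumes "l \<in> labels m" and "n < m" and "label_endpoint l \<le> n"
  shows "rep m l (A1 m) n (Suc n) \<noteq> 0"
proof -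
  obtain p q where l: "l = (p, q)" by fastforce
  have pq: "2 * p \<le> m" "2 * q \<le> m + 1" "2 * p \<le> n" "2 * q \<le> n + 1"
    using assms by (auto simp: l labels_def label_endpoint_def endpoint_def)
  show ?thesis
  proof (cases "even n")
    case True
    then obtain k where n: "n = 2 * k" by (rule evenE)
    have t: "dist_level m n = m - k" by (simp add: dist_level_def n)
    have 2: "level_dist m (m - (m - k)) = Suc n" using assms(2) n by (simp add: level_dist_def)
    have e: "complex_of_nat (m - k) + 1 - complex_of_nat q = complex_of_nat (m - k + 1 - q)"
      using pq n assms(2) by (simp add: of_nat_diff)
    have nz: "m - k + 1 - q \<noteq> 0" using pq n assms(2) by simp
    show ?thesis
    proof (cases k)
      \<comment> \<open>For n = 0 the truncated \<open>m - t - 1\<close> yields level 0, which also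
        lies at distance 1, so both indicators fire; the spurious term has coefficient m - m - 0 =
        0.\<close>
      case 0
      then have "p = 0" "q = 0" using pq n by auto
      moreover have "complex_of_nat m + 1 \<noteq> 0" using of_nat_neq_0[of m] by (simp add: add.commute)
      ultimately show ?thesis using assms 0 n
        by (subst rep_A1) (auto simp: dist_level_def l level_dist_def)
    next
      case (Suc k')
      then have "level_dist m (m - (m - k) - 1) \<noteq> Suc n"
        using assms(2) n by (simp add: level_dist_def)
      moreover have "complex_of_nat (m - k) + 1 - complex_of_nat q \<noteq> 0"
        using e nz by (metis of_nat_eq_0_iff)
      ultimately show ?thesis
        unfolding rep_A1[OF assms(1) less_imp_le[OF assms(2)] assms(3)] t 2 by (simp add: l)
    qed
  next
    case False
    then obtain k where n: "n = 2 * k + 1" by (rule oddE)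
    have t: "dist_level m n = k" by (simp add: dist_level_def n)
    have 1: "level_dist m (m - k - 1) = Suc n" "level_dist m (m - k) \<noteq> Suc n"
      using assms(2) n by (auto simp: level_dist_def)
    have "complex_of_nat m - complex_of_nat k - complex_of_nat p = complex_of_nat (m - k - p)"
      using pq n assms(2) by (simp add: of_nat_diff)
    moreover have "m - k - p \<noteq> 0" using pq n assms(2) by simp
    ultimately have "complex_of_nat m - complex_of_nat k - complex_of_nat p \<noteq> 0"
      by (metis of_nat_eq_0_iff)
    then show ?thesis using 1
      unfolding rep_A1[OF assms(1) less_imp_le[OF assms(2)] assms(3)] t by (simp add: l)
  qed
qed

text \<open>The entry is, up to sign, k + 1 - p or k + 1 - q. Parity keeps it positive: 2p <= 2k + 1
  forces p <= k, and likewise for q.\<close>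

lemma rep_A1_down_nonzero:
  assumes "l \<in> labels m" and "n < m" and "label_endpoint l \<le> n"
  shows "rep m l (A1 m) (Suc n) n \<noteq> 0"
proof -
  obtain p q where l: "l = (p, q)" by fastforce
  have pq: "2 * p \<le> n" "2 * q \<le> n + 1"
    using assms by (auto simp: l labels_def label_endpoint_def endpoint_def)
  have sn: "Suc n \<le> m" "label_endpoint l \<le> Suc n" using assms by auto
  show ?thesis
  proof (cases "even n")
    case False
    then obtain k where n: "n = 2 * k + 1" by (rule oddE)
    have t: "dist_level m (Suc n) = m - (k + 1)" by (simp add: dist_level_def n)
    have 1: "level_dist m (m - (m - (k + 1)) - 1) = n" "level_dist m (m - (m - (k + 1))) \<noteq> n"
      using assms(2) n by (auto simp: level_dist_def)
    have "complex_of_nat m - complex_of_nat (m - (k + 1)) - complex_of_nat p = complex_of_nat (k + 1 - p)"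
      using pq n assms(2) by (simp add: of_nat_diff)
    moreover have "k + 1 - p \<noteq> 0" using pq n by simp
    ultimately have "complex_of_nat m - complex_of_nat (m - (k + 1)) - complex_of_nat p \<noteq> 0"
      by (metis of_nat_eq_0_iff)
    then show ?thesis using 1 unfolding rep_A1[OF assms(1) sn] t by (simp add: l)
  next
    case True
    then obtain k where n: "n = 2 * k" by (rule evenE)
    have t: "dist_level m (Suc n) = k" by (simp add: dist_level_def n)
    have 1: "level_dist m (m - k - 1) \<noteq> n" "level_dist m (m - k) = n"
      using assms(2) n by (auto simp: level_dist_def)
    have "complex_of_nat k + 1 - complex_of_nat q = complex_of_nat (k + 1 - q)"
      using pq n by (simp add: of_nat_diff)
    moreover have "k + 1 - q \<noteq> 0" using pq n by simp
    ultimately have "complex_of_nat k + 1 - complex_of_nat q \<noteq> 0"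
      by (metis of_nat_eq_0_iff)
    then show ?thesis using 1 unfolding rep_A1[OF assms(1) sn] t by (simp add: l)
  qed
qed

section \<open>Separating the labels at distance m\<close>

lemma mult_Suc_inj: "x * Suc x = y * Suc y \<Longrightarrow> x = y" for x y :: nat
  using mult_strict_mono[of x y "Suc x" "Suc y"] mult_strict_mono[of y x "Suc y" "Suc x"]
  by (cases x y rule: linorder_cases) auto

text \<open>The sign of an entry depends on the unknown label, so entries are compared in absolute
  value.\<close>

lemma signed_nat_eq:
  assumes "(-1) ^ a * complex_of_nat x = (-1) ^ b * complex_of_nat y"
  shows "x = y"
proof -
  have "norm ((-1) ^ a * complex_of_nat x) = norm ((-1) ^ b * complex_of_nat y)"
    using assms by simp
  then show ?thesis by (simp add: norm_mult norm_power)
qed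

text \<open>Here distances m and m - 1 are levels g + 1 and g. The diagonal entry involves q up to
  sign, the two-step product only p, its two signs cancelling.\<close>

lemma corner_even:
  assumes "(p, q) \<in> labels m" and m: "m = 2 * g + 2"
  shows "rep m (p, q) (A1 m) m m = (-1) ^ (p + q) * of_nat (g + 2 - q)"
    "rep m (p, q) (A1 m) m (m - 1) * rep m (p, q) (A1 m) (m - 1) m
      = of_nat ((g + 1 - p) * Suc (g + 1 - p))"
proof -
  have pq: "p \<le> g + 1" "q \<le> g + 1" using assms by (auto simp: labels_def)
  have r: "label_endpoint (p, q) \<le> m" using label_endpoint_le[OF assms(1)] .
  have t: "dist_level m m = g + 1" "dist_level m (m - 1) = g" by (simp_all add: dist_level_def m)
  have d: "level_dist m (m - (g + 1) - 1) = m - 1" "level_dist m (m - (g + 1)) = m"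
    "level_dist m (m - g - 1) = m" "level_dist m (m - g) \<noteq> m"
    by (simp_all add: level_dist_def m)
  show "rep m (p, q) (A1 m) m m = (-1) ^ (p + q) * of_nat (g + 2 - q)"
    unfolding rep_A1[OF assms(1) order_refl r] t d using pq m by (simp add: of_nat_diff)
  have up: "rep m (p, q) (A1 m) m (m - 1) = (-1) ^ (p + q) * of_nat (g + 1 - p)"
    unfolding rep_A1[OF assms(1) order_refl r] t d using pq m by (simp add: of_nat_diff)
  show "rep m (p, q) (A1 m) m (m - 1) * rep m (p, q) (A1 m) (m - 1) m
      = of_nat ((g + 1 - p) * Suc (g + 1 - p))"
  proof (cases "p = g + 1")
    \<comment> \<open>The endpoint is then m, so row m - 1 is outside the block and
      \<open>rep_A1\<close> does not apply there; the factor g + 1 - p already makes the product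
      0.\<close>
    case True
    then show ?thesis unfolding up by simp
  next
    case False
    then have "label_endpoint (p, q) \<le> m - 1" using pq m by (auto simp: label_endpoint_def endpoint_def)
    then have "rep m (p, q) (A1 m) (m - 1) m = (-1) ^ (p + q) * of_nat (Suc (g + 1 - p))"
      unfolding rep_A1[OF assms(1) diff_le_self \<open>label_endpoint (p, q) \<le> m - 1\<close>] t d
      using d(4) pq m by (simp add: of_nat_diff)
    then show ?thesis unfolding up by (simp add: ring_distribs mult_ac flip: power_mult_distrib)
  qed
qed

text \<open>Distances m and m - 1 are now levels g + 1 and g + 2, which exchanges the parts of p and
  q.\<close>

lemma corner_odd:
  assumes "(p, q) \<in> labels m" and m: "m = 2 * g + 3"
  shows "rep m (p, q) (A1 m) m m = (-1) ^ (p + q) * of_nat (g + 2 - p)"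
    "rep m (p, q) (A1 m) m (m - 1) * rep m (p, q) (A1 m) (m - 1) m
      = of_nat ((g + 2 - q) * Suc (g + 2 - q))"
proof -
  have pq: "p \<le> g + 1" "q \<le> g + 2" using assms by (auto simp: labels_def)
  have r: "label_endpoint (p, q) \<le> m" using label_endpoint_le[OF assms(1)] .
  have t: "dist_level m m = g + 1" "dist_level m (m - 1) = g + 2" by (simp_all add: dist_level_def m)
  have d: "level_dist m (m - (g + 1) - 1) = m" "level_dist m (m - (g + 1)) = m - 1"
    "level_dist m (m - (g + 2) - 1) \<noteq> m" "level_dist m (m - (g + 2)) = m"
    by (simp_all add: level_dist_def m)
  show "rep m (p, q) (A1 m) m m = (-1) ^ (p + q) * of_nat (g + 2 - p)"
    unfolding rep_A1[OF assms(1) order_refl r] t d using pq m by (simp add: of_nat_diff)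
  have up: "rep m (p, q) (A1 m) m (m - 1) = (-1) ^ (p + q) * of_nat (g + 2 - q)"
    unfolding rep_A1[OF assms(1) order_refl r] t d using pq m by (simp add: of_nat_diff)
  show "rep m (p, q) (A1 m) m (m - 1) * rep m (p, q) (A1 m) (m - 1) m
      = of_nat ((g + 2 - q) * Suc (g + 2 - q))"
  proof (cases "q = g + 2")
    case True
    then show ?thesis unfolding up by simp
  next
    case False
    then have "label_endpoint (p, q) \<le> m - 1" using pq m by (auto simp: label_endpoint_def endpoint_def)
    then have "rep m (p, q) (A1 m) (m - 1) m = (-1) ^ (p + q) * of_nat (Suc (g + 2 - q))"
      unfolding rep_A1[OF assms(1) diff_le_self \<open>label_endpoint (p, q) \<le> m - 1\<close>] t d
      using d(3) pq m by (simp add: of_nat_diff)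
    then show ?thesis unfolding up by (simp add: ring_distribs mult_ac flip: power_mult_distrib)
  qed
qed

lemma corner_separates:
  assumes "l \<in> labels m" and "l' \<in> labels m" and "m \<ge> 2"
    and "rep m l (A1 m) m m = rep m l' (A1 m) m m"
    and "rep m l (A1 m) m (m - 1) * rep m l (A1 m) (m - 1) m
      = rep m l' (A1 m) m (m - 1) * rep m l' (A1 m) (m - 1) m"
  shows "l = l'"
proof -
  obtain p q p' q' where l: "l = (p, q)" "l' = (p', q')" by fastforce
  have L: "(p, q) \<in> labels m" "(p', q') \<in> labels m" using assms l by auto
  then have b: "2 * p \<le> m" "2 * p' \<le> m" "2 * q \<le> m + 1" "2 * q' \<le> m + 1" by (auto simp: labels_def)
  show ?thesis
  proof (cases "even m")
    case True
    then obtain h where "m = 2 * h" by (rule evenE)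
    then obtain g where m: "m = 2 * g + 2" using assms(3) by (cases h) auto
    have "p = p'" "q = q'"
      using signed_nat_eq[OF assms(4)[unfolded l corner_even(1)[OF L(1) m] corner_even(1)[OF L(2) m]]]
        mult_Suc_inj[OF assms(5)[unfolded l corner_even(2)[OF L(1) m] corner_even(2)[OF L(2) m] of_nat_eq_iff]]
        b m by linarith+
    then show ?thesis using l by simp
  next
    case False
    then obtain h where "m = 2 * h + 1" by (rule oddE)
    then obtain g where m: "m = 2 * g + 3" using assms(3) by (cases h) auto
    have "p = p'" "q = q'"
      using signed_nat_eq[OF assms(4)[unfolded l corner_odd(1)[OF L(1) m] corner_odd(1)[OF L(2) m]]]
        mult_Suc_inj[OF assms(5)[unfolded l corner_odd(2)[OF L(1) m] corner_odd(2)[OF L(2) m] of_nat_eq_iff]]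
        b m by linarith+
    then show ?thesis using l by simp
  qed
qed

lemma separating_corner:
  assumes "l \<in> labels m" and "l' \<in> labels m" and "l \<noteq> l'" and "m \<ge> 2"
  shows "\<exists>M c. acts_as m M m m c \<and> c l \<noteq> c l'"
proof -
  let ?C = "\<lambda>a b. vmat_mult m (Estar m a) (vmat_mult m (A1 m) (Estar m b))"
  have A: "A1 m \<in> terwilliger m" by (rule terwilliger.gen_A)
  have 1: "acts_as m (?C m m) m m (\<lambda>l. rep m l (A1 m) m m)"
    using acts_as_corner[OF A] by simp
  have 2: "acts_as m (vmat_mult m (?C m (m - 1)) (?C (m - 1) m)) m m
      (\<lambda>l. rep m l (A1 m) m (m - 1) * rep m l (A1 m) (m - 1) m)"
    by (intro acts_as_mult[of m _ m "m - 1"] acts_as_corner[OF A]) simp_all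
  show ?thesis using corner_separates[OF assms(1,2,4)] assms(3) 1 2 by blast
qed

text \<open>Lagrange interpolation on the labels: each \<open>l\<close> in \<open>F\<close>
  contributes a factor (e - e l) / (e l0 - e l). \<open>Estar m m\<close> serves as the constant
  function 1 because every endpoint is at most m.\<close>

lemma corner_interpolation:
  assumes "finite F" and "F \<subseteq> labels m" and "l0 \<in> labels m" and "l0 \<notin> F" and "m \<ge> 2"
  shows "\<exists>M c. acts_as m M m m c \<and> c l0 = 1 \<and> (\<forall>l\<in>F. c l = 0)"
  using assms(1,2,4)
proof (induction F)
  case empty
  then show ?case using acts_as_Estar[of m m] label_endpoint_le[OF assms(3)]
    by (intro exI[of _ "Estar m m"] exI[of _ "\<lambda>l. of_bool (label_endpoint l \<le> m)"]) simp
next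
  case (insert l F)
  then obtain M c where M: "acts_as m M m m c" "c l0 = 1" "\<forall>l\<in>F. c l = 0" by auto
  obtain N e where N: "acts_as m N m m e" "e l0 \<noteq> e l"
    using separating_corner[OF assms(3), of l] insert.prems assms(5) by auto
  let ?k = "1 / (e l0 - e l)"
  have E: "acts_as m (Estar m m) m m (\<lambda>l. of_bool (label_endpoint l \<le> m))"
    by (rule acts_as_Estar) simp
  let ?c = "\<lambda>l'. ?k * (e l' + - e l * of_bool (label_endpoint l' \<le> m)) * c l'"
  have "?c l0 = 1" using M(2) N(2) label_endpoint_le[OF assms(3)] by simp
  moreover have "\<forall>l'\<in>insert l F. ?c l' = 0" using M(3) label_endpoint_le[of l m] insert.prems by simp
  ultimately show ?case
    using acts_as_mult[OF acts_as_smult[OF acts_as_add[OF N(1) acts_as_smult[OF E, of "- e l"]], of ?k]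
      M(1) order_refl]
    by (intro exI[of _ ?c] exI[of "\<lambda>M. \<exists>c. P M c" for P] conjI)
qed

section \<open>Transport between distance m and other distances\<close>

lemma transition_to_top:
  assumes "n \<le> m"
  shows "\<exists>M c. acts_as m M n m c \<and> (\<forall>l\<in>labels m. label_endpoint l \<le> n \<longrightarrow> c l \<noteq> 0)"
  using assms
proof (induction rule: inc_induct)
  case base
  show ?case using acts_as_Estar[of m m]
    by (intro exI[of _ "Estar m m"] exI[of _ "\<lambda>l. of_bool (label_endpoint l \<le> m)"]) simp
next
  case (step n)
  then obtain M c where M: "acts_as m M (Suc n) m c" "\<And>l. l \<in> labels m \<Longrightarrow> label_endpoint l \<le> Suc n \<Longrightarrow> c l \<noteq> 0"
    by blast
  have "acts_as m (vmat_mult m (vmat_mult m (Estar m n) (vmat_mult m (A1 m) (Estar m (Suc n)))) M)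
      n m (\<lambda>l. rep m l (A1 m) n (Suc n) * c l)"
    using step by (intro acts_as_mult[OF _ M(1)] acts_as_corner terwilliger.gen_A) simp_all
  moreover have "\<forall>l\<in>labels m. label_endpoint l \<le> n \<longrightarrow> rep m l (A1 m) n (Suc n) * c l \<noteq> 0"
    using rep_A1_up_nonzero M(2) step by simp
  ultimately show ?case by blast
qed

lemma transition_from_top:
  assumes "n \<le> m"
  shows "\<exists>M c. acts_as m M m n c \<and> (\<forall>l\<in>labels m. label_endpoint l \<le> n \<longrightarrow> c l \<noteq> 0)"
  using assms
proof (induction rule: inc_induct)
  case base
  show ?case using acts_as_Estar[of m m]
    by (intro exI[of _ "Estar m m"] exI[of _ "\<lambda>l. of_bool (label_endpoint l \<le> m)"]) simp
next
  case (step n)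
  then obtain M c where M: "acts_as m M m (Suc n) c" "\<And>l. l \<in> labels m \<Longrightarrow> label_endpoint l \<le> Suc n \<Longrightarrow> c l \<noteq> 0"
    by blast
  have "acts_as m (vmat_mult m M (vmat_mult m (Estar m (Suc n)) (vmat_mult m (A1 m) (Estar m n))))
      m n (\<lambda>l. c l * rep m l (A1 m) (Suc n) n)"
    using step by (intro acts_as_mult[OF M(1)] acts_as_corner terwilliger.gen_A) simp_all
  moreover have "\<forall>l\<in>labels m. label_endpoint l \<le> n \<longrightarrow> c l * rep m l (A1 m) (Suc n) n \<noteq> 0"
    using rep_A1_down_nonzero M(2) step by simp
  ultimately show ?case by blast
qed

text \<open>The indicator of \<open>l0\<close> at position (m, m) is carried to (a, b) along both
  paths; dividing by the scalars picked up at \<open>l0\<close> normalises it.\<close>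

lemma matrix_unit:
  assumes "l0 \<in> labels m" and "label_endpoint l0 \<le> a" "a \<le> m" and "label_endpoint l0 \<le> b" "b \<le> m" and "m \<ge> 2"
  shows "\<exists>M. acts_as m M a b (\<lambda>l. of_bool (l = l0))"
proof -
  obtain U c where U: "acts_as m U a m c" "c l0 \<noteq> 0"
    using transition_to_top[OF assms(3)] assms(1,2) by blast
  obtain V e where V: "acts_as m V m b e" "e l0 \<noteq> 0"
    using transition_from_top[OF assms(5)] assms(1,4) by blast
  obtain Z f where Z: "acts_as m Z m m f" "f l0 = 1" "\<forall>l\<in>labels m - {l0}. f l = 0"
    using corner_interpolation[of "labels m - {l0}" m l0] assms(1,6) by auto
  have "acts_as m (\<lambda>x y. 1 / (c l0 * e l0) * vmat_mult m (vmat_mult m U Z) V x y) a b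
      (\<lambda>l. 1 / (c l0 * e l0) * (c l * f l * e l))"
    using U(1) V(1) Z(1) by (intro acts_as_smult acts_as_mult[where b = m]) auto
  moreover have "1 / (c l0 * e l0) * (c l * f l * e l) = of_bool (l = l0)" if "l \<in> labels m" for l
    using that U(2) V(2) Z by (cases "l = l0") auto
  ultimately have "acts_as m (\<lambda>x y. 1 / (c l0 * e l0) * vmat_mult m (vmat_mult m U Z) V x y) a b
      (\<lambda>l. of_bool (l = l0))"
    by (simp add: acts_as_def)
  then show ?thesis by (intro exI)
qed


section \<open>The dimension bound\<close>

text \<open>The dual functionals make the vectors \<tau> independent, and being at least as many as
  the spanning vectors, they fill the span. In this form the dimension count says that the values of
  \<open>f\<close> determine \<open>v\<close>.\<close>

lemma (in vector_space) biorthogonal_expansion: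
  assumes "finite I" and "finite B" and "card B \<le> card I" and "\<And>i. i \<in> I \<Longrightarrow> \<tau> i \<in> span B"
    and add: "\<And>i x y. f i (x + y) = f i x + f i y" and scale: "\<And>i c x. f i (scale c x) = c * f i x"
    and dual: "\<And>i j. i \<in> I \<Longrightarrow> j \<in> I \<Longrightarrow> f i (\<tau> j) = (if i = j then 1 else 0)"
    and v: "v \<in> span B"
  shows "v = (\<Sum>i\<in>I. scale (f i v) (\<tau> i))"
proof -
  have f0: "f i 0 = 0" for i using scale[of i 0 0] by simp
  have fsum: "f i (\<Sum>j\<in>J. scale (c j) (g j)) = (\<Sum>j\<in>J. c j * f i (g j))" for i J c and g :: "'k \<Rightarrow> 'b"
    by (induction J rule: infinite_finite_induct) (simp_all add: f0 add scale)
  have inj: "inj_on \<tau> I"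
    using dual by (intro inj_onI) (metis zero_neq_one)
  have ind: "independent (\<tau> ` I)"
  proof (rule independent_if_scalars_zero)
    fix c x assume "(\<Sum>x\<in>\<tau> ` I. scale (c x) x) = 0" and "x \<in> \<tau> ` I"
    then obtain i where i: "i \<in> I" "x = \<tau> i" by blast
    have "f i (\<Sum>j\<in>I. scale (c (\<tau> j)) (\<tau> j)) = 0"
      using \<open>(\<Sum>x\<in>\<tau> ` I. scale (c x) x) = 0\<close> inj f0 by (simp add: sum.reindex)
    then have "(\<Sum>j\<in>I. if j = i then c x else 0) = 0"
      unfolding fsum using dual i by (subst (asm) sum.cong[OF refl]) (auto intro: sum.cong)
    then show "c x = 0" using i assms(1) by simp
  qed (use assms(1) in simp)
  have sub: "\<tau> ` I \<subseteq> span B" using assms(4) by blast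
  have "v \<in> span (\<tau> ` I)"
  proof (rule ccontr)
    assume nv: "v \<notin> span (\<tau> ` I)"
    have "independent (insert v (\<tau> ` I))" using independent_insertI[OF nv ind] .
    then have "card (insert v (\<tau> ` I)) \<le> card B"
      using independent_span_bound[OF assms(2), of "insert v (\<tau> ` I)"] sub v by simp
    moreover have "v \<notin> \<tau> ` I" using nv span_base by blast
    ultimately show False using assms(1,3) by (simp add: card_image[OF inj])
  qed
  then show ?thesis
  proof (induction rule: span_induct_alt)
    case base
    then show ?case by (simp add: f0)
  next
    case (step c x y)
    then obtain k where k: "k \<in> I" "x = \<tau> k" by blast
    have "(\<Sum>i\<in>I. scale (f i (scale c x)) (\<tau> i)) = (\<Sum>i\<in>I. if i = k then scale c x else 0)"
      using k dual by (intro sum.cong) (auto simp: scale)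
    then have "(\<Sum>i\<in>I. scale (f i (scale c x)) (\<tau> i)) = scale c x"
      using k assms(1) by simp
    then show ?case using step(2)
      by (simp add: add scale_left_distrib sum.distrib)
  qed
qed

section \<open>Invariance under permutations fixing the base vertex\<close>

lemma terwilliger_outside:
  assumes "M \<in> terwilliger m" and "y \<notin> odd_X m \<or> z \<notin> odd_X m"
  shows "M y z = 0"
  using assms
proof (induction arbitrary: y z)
  case gen_A
  then show ?case by (auto simp: A1_def odd_adj_def)
next
  case (gen_E i)
  then show ?case by (auto simp: Estar_def)
next
  case (mult A B)
  then show ?case unfolding vmat_mult_def by (intro sum.neutral) auto
qed simp_all

text \<open>Such a permutation induces a graph automorphism that fixes \<open>base_x0 m\<close>,
  hence preserves adjacency and every distance class, and it permutes the summation index of a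
  product.\<close>

lemma terwilliger_invariant:
  assumes M: "M \<in> terwilliger m" and \<pi>: "\<pi> permutes ground m" "\<pi> ` base_x0 m = base_x0 m"
  shows "M (\<pi> ` y) (\<pi> ` z) = M y z"
proof -
  have inj: "inj \<pi>" using \<pi>(1) by (rule permutes_inj)
  have X: "\<pi> ` y \<in> odd_X m \<longleftrightarrow> y \<in> odd_X m" for y
  proof -
    have "\<pi> ` y \<subseteq> \<pi> ` ground m \<longleftrightarrow> y \<subseteq> ground m" using inj by (rule inj_image_subset_iff)
    then show ?thesis
      using inj by (simp add: odd_X_iff permutes_image[OF \<pi>(1)] card_image inj_on_subset[OF inj])
  qed
  have lv: "level m (\<pi> ` y) = level m y" for y
  proof -
    have "\<pi> ` y \<inter> base_x0 m = \<pi> ` (y \<inter> base_x0 m)" using \<pi>(2) inj by (simp add: image_Int)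
    then show ?thesis using inj by (simp add: level_def card_image inj_on_subset[OF inj])
  qed
  have bij: "bij_betw ((`) \<pi>) (odd_X m) (odd_X m)"
    unfolding bij_betw_def
  proof (intro conjI)
    show "inj_on ((`) \<pi>) (odd_X m)" using inj by (auto simp: inj_on_def inj_image_eq_iff)
    then show "(`) \<pi> ` odd_X m = odd_X m" using X
      by (intro card_subset_eq) (auto simp: card_image)
  qed
  show ?thesis using M
  proof (induction arbitrary: y z)
    case gen_A
    have "\<pi> ` y \<inter> \<pi> ` z = {} \<longleftrightarrow> y \<inter> z = {}" using inj by (auto simp: inj_eq)
    then show ?case by (simp add: A1_def odd_adj_def X)
  next
    case (gen_E i)
    then show ?case using inj by (simp add: Estar_eq X vdist_def lv inj_image_eq_iff)
  next
    case (mult A B)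
    have "vmat_mult m A B (\<pi> ` y) (\<pi> ` z) = (\<Sum>w\<in>odd_X m. A (\<pi> ` y) (\<pi> ` w) * B (\<pi> ` w) (\<pi> ` z))"
      unfolding vmat_mult_def by (rule sum.reindex_bij_betw[OF bij, symmetric])
    then show ?case using mult.IH by (simp add: vmat_mult_def)
  qed simp_all
qed

definition orbit_type :: "nat \<Rightarrow> nat set \<Rightarrow> nat set \<Rightarrow> nat \<times> nat \<times> nat \<times> nat" where
  "orbit_type m y z =
    (level m y, level m z, card (y \<inter> z \<inter> base_x0 m), card (y \<inter> z \<inter> outer m))"

lemma card_cell:
  assumes "finite C"
  shows "card {x \<in> C. (x \<in> y) = a \<and> (x \<in> z) = b} =
    (if a then if b then card (y \<inter> z \<inter> C) else card (y \<inter> C) - card (y \<inter> z \<inter> C)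
     else if b then card (z \<inter> C) - card (y \<inter> z \<inter> C)
     else card C - (card (y \<inter> C) + card (z \<inter> C) - card (y \<inter> z \<inter> C)))"
proof -
  have "{x \<in> C. x \<in> y \<and> x \<in> z} = y \<inter> z \<inter> C" by blast
  then have c1: "card {x \<in> C. x \<in> y \<and> x \<in> z} = card (y \<inter> z \<inter> C)" by (rule arg_cong)
  have "{x \<in> C. x \<in> y \<and> x \<notin> z} = (y \<inter> C) - (y \<inter> z \<inter> C)" by blast
  moreover have "card \<dots> = card (y \<inter> C) - card (y \<inter> z \<inter> C)"
    using assms by (intro card_Diff_subset) auto
  ultimately have c2: "card {x \<in> C. x \<in> y \<and> x \<notin> z} = card (y \<inter> C) - card (y \<inter> z \<inter> C)"
    by (simp only:)
  have "{x \<in> C. x \<notin> y \<and> x \<in> z} = (z \<inter> C) - (y \<inter> z \<inter> C)" by blast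
  moreover have "card \<dots> = card (z \<inter> C) - card (y \<inter> z \<inter> C)"
    using assms by (intro card_Diff_subset) auto
  ultimately have c3: "card {x \<in> C. x \<notin> y \<and> x \<in> z} = card (z \<inter> C) - card (y \<inter> z \<inter> C)"
    by (simp only:)
  have "{x \<in> C. x \<notin> y \<and> x \<notin> z} = C - ((y \<inter> C) \<union> (z \<inter> C))" by blast
  moreover have "card \<dots> = card C - card ((y \<inter> C) \<union> (z \<inter> C))"
    using assms by (intro card_Diff_subset) auto
  moreover have "(y \<inter> C) \<inter> (z \<inter> C) = y \<inter> z \<inter> C" by blast
  then have "card ((y \<inter> C) \<union> (z \<inter> C)) = card (y \<inter> C) + card (z \<inter> C) - card (y \<inter> z \<inter> C)"
    using card_Un_Int[of "y \<inter> C" "z \<inter> C"] assms by (metis add_diff_cancel_right' finite_Int)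
  ultimately have c4: "card {x \<in> C. x \<notin> y \<and> x \<notin> z}
      = card C - (card (y \<inter> C) + card (z \<inter> C) - card (y \<inter> z \<inter> C))"
    by (simp only:)
  show ?thesis by (cases a; cases b) (simp_all only: c1 c2 c3 c4 simp_thms if_True if_False)
qed

text \<open>Membership in \<open>base_x0 m\<close>, in y and in z cuts the ground set into eight
  cells. The type determines all cell sizes, so some permutation carries cells to cells.\<close>

lemma orbit_transitive:
  assumes "y \<in> odd_X m" "z \<in> odd_X m" "y' \<in> odd_X m" "z' \<in> odd_X m"
    and "orbit_type m y z = orbit_type m y' z'"
  obtains \<pi> where "\<pi> permutes ground m" "\<pi> ` base_x0 m = base_x0 m" "\<pi> ` y = y'" "\<pi> ` z = z'"
proof -
  let ?c = "\<lambda>y z x. (x \<in> base_x0 m, x \<in> y, x \<in> z)"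
  have cells: "card {x \<in> ground m. ?c y z x = v} = card {x \<in> ground m. ?c y' z' x = v}" for v
  proof -
    obtain e a b where v: "v = (e, a, b)" by (metis prod_cases3)
    have "{x \<in> ground m. ?c y z x = v}
        = {x \<in> if e then base_x0 m else outer m. (x \<in> y) = a \<and> (x \<in> z) = b}" for y z
      using base_outer(1,2)[of m] by (auto simp: v)
    then show ?thesis
      using assms(5) base_outer(3,4)[of m] card_outer[OF assms(1)] card_outer[OF assms(2)]
        card_outer[OF assms(3)] card_outer[OF assms(4)]
      by (cases e) (simp_all add: card_cell orbit_type_def level_def)
  qed
  \<comment> \<open>Equality of cell sizes is recast as equality of multisets of cell names, from
    which the permutation can be extracted.\<close>
  have "image_mset (?c y z) (mset_set (ground m)) = image_mset (?c y' z') (mset_set (ground m))"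
  proof (rule multiset_eqI)
    have "count (image_mset g (mset_set (ground m))) v = card {x \<in> ground m. g x = v}"
      for g :: "nat \<Rightarrow> bool \<times> bool \<times> bool" and v
      by (simp add: count_image_mset' eq_commute)
    then show "count (image_mset (?c y z) (mset_set (ground m))) v
        = count (image_mset (?c y' z') (mset_set (ground m))) v" for v
      using cells by presburger
  qed
  then obtain \<pi> where \<pi>: "\<pi> permutes ground m" "\<forall>x\<in>ground m. ?c y z x = ?c y' z' (\<pi> x)"
    using image_mset_eq_implies_permutes[OF finite_ground] by blast
  have im: "\<pi> ` A = A'" if "A \<subseteq> ground m" "A' \<subseteq> ground m" "\<And>x. x \<in> ground m \<Longrightarrow> x \<in> A \<longleftrightarrow> \<pi> x \<in> A'"
    for A A'
  proof (intro equalityI subsetI)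
    fix x assume "x \<in> A'"
    then have "x \<in> \<pi> ` ground m" using that(2) permutes_image[OF \<pi>(1)] by auto
    then show "x \<in> \<pi> ` A" using that(3) \<open>x \<in> A'\<close> by auto
  qed (use that in auto)
  show ?thesis
    using \<pi> assms(1-4) base_outer(1)[of m]
    by (intro that[of \<pi>] im) (auto simp: odd_X_iff)
qed

section \<open>Counting orbits\<close>

definition orbit_types :: "nat \<Rightarrow> (nat \<times> nat \<times> nat \<times> nat) set" where
  "orbit_types m = (\<lambda>(y, z). orbit_type m y z) ` (odd_X m \<times> odd_X m)"

definition unit_index :: "nat \<Rightarrow> ((nat \<times> nat) \<times> nat \<times> nat) set" where
  "unit_index m = {(l, i, j). l \<in> labels m \<and> label_endpoint l \<le> i \<and> i \<le> m \<and> label_endpoint l \<le> j \<and> j \<le> m}"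

lemma finite_unit_index [simp]: "finite (unit_index m)"
  by (rule finite_subset[of _ "labels m \<times> {..m} \<times> {..m}"]) (auto simp: unit_index_def)

text \<open>Inclusion-exclusion inside the m points of \<open>base_x0 m\<close> gives
  \<open>t + t' \<le> m + s\<close>; inside the m + 1 points of \<open>outer m\<close> it gives the
  last bound.\<close>

lemma orbit_types_bounds:
  assumes "(t, t', s, s') \<in> orbit_types m"
  shows "t \<le> m" "t' \<le> m" "s \<le> t" "s \<le> t'" "t + t' \<le> m + s"
    "s' + t \<le> m" "s' + t' \<le> m" "m \<le> s' + 1 + t + t'"
proof -
  obtain y z where yz: "y \<in> odd_X m" "z \<in> odd_X m" and o': "orbit_type m y z = (t, t', s, s')"
    using assms by (auto simp: orbit_types_def)
  have e: "t = card (y \<inter> base_x0 m)" "t' = card (z \<inter> base_x0 m)"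
    "s = card (y \<inter> z \<inter> base_x0 m)" "s' = card (y \<inter> z \<inter> outer m)"
    using o' by (auto simp: orbit_type_def level_def)
  show le: "t \<le> m" "t' \<le> m" using e level_le by (auto simp: level_def)
  show "s \<le> t" "s \<le> t'" unfolding e using base_outer(3) by (auto intro!: card_mono)
  have o: "card (y \<inter> outer m) = m - t" "card (z \<inter> outer m) = m - t'"
    using card_outer yz e by (auto simp: level_def)
  have "s' \<le> card (y \<inter> outer m)" "s' \<le> card (z \<inter> outer m)"
    unfolding e using base_outer(4) by (auto intro!: card_mono)
  then show "s' + t \<le> m" "s' + t' \<le> m" using o le by auto
  have "card ((y \<inter> C) \<union> (z \<inter> C)) + card (y \<inter> z \<inter> C) = card (y \<inter> C) + card (z \<inter> C)
      \<and> card ((y \<inter> C) \<union> (z \<inter> C)) \<le> card C" if "finite C" for C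
    using card_Un_Int[of "y \<inter> C" "z \<inter> C"] that by (auto simp: Int_ac intro!: card_mono)
  from this[OF base_outer(3)[of m]] this[OF base_outer(4)[of m]]
  show "t + t' \<le> m + s" "m \<le> s' + 1 + t + t'"
    using e o le base_outer(5,6)[of m] by auto
qed

text \<open>For fixed levels t and t', the two intersection sizes range over intervals, which are
  shifted to start at 0 in order to obtain labels.\<close>
lemma card_orbit_types_le: "card (orbit_types m) \<le> card (unit_index m)"
proof -
  let ?f = "\<lambda>(t, t', s, s'). ((s - (t + t' - m), s' - (m - 1 - (t + t'))),
    level_dist m t, level_dist m t')"
  have "inj_on ?f (orbit_types m)"
  proof (rule inj_onI)
    fix u v assume u: "u \<in> orbit_types m" and v: "v \<in> orbit_types m" and eq: "?f u = ?f v"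
    obtain t t' s s' where u': "u = (t, t', s, s')" by (metis prod_cases4)
    obtain r r' w w' where v': "v = (r, r', w, w')" by (metis prod_cases4)
    have bu: "t \<le> m" "t' \<le> m" "t + t' \<le> m + s" "m \<le> s' + 1 + t + t'"
      using orbit_types_bounds[OF u[unfolded u']] by auto
    have bv: "r \<le> m" "r' \<le> m" "r + r' \<le> m + w" "m \<le> w' + 1 + r + r'"
      using orbit_types_bounds[OF v[unfolded v']] by auto
    have e: "s - (t + t' - m) = w - (r + r' - m)"
      "s' - (m - 1 - (t + t')) = w' - (m - 1 - (r + r'))"
      "level_dist m t = level_dist m r" "level_dist m t' = level_dist m r'"
      using eq by (simp_all add: u' v')
    have tr: "t = r" "t' = r'"
      using e(3,4) bu(1,2) bv(1,2) by (metis dist_level_dist)+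
    have "s = w" using e(1) bu(3) bv(3) unfolding tr by linarith
    moreover have "s' = w'" using e(2) bu(4) bv(4) unfolding tr by linarith
    ultimately show "u = v" by (simp add: u' v' tr)
  qed
  moreover have "?f ` orbit_types m \<subseteq> unit_index m"
  proof
    fix x assume "x \<in> ?f ` orbit_types m"
    then obtain t t' s s' where x: "x = ?f (t, t', s, s')" and o': "(t, t', s, s') \<in> orbit_types m" by auto
    note b = orbit_types_bounds[OF o']
    define p q where "p = s - (t + t' - m)" and "q = s' - (m - 1 - (t + t'))"
    \<comment> \<open>For each of the two levels these are the four bounds that define
      \<open>endpoint\<close>.\<close>
    have "p \<le> t" "p \<le> t'" "p \<le> m - t" "p \<le> m - t'" "q \<le> t + 1" "q \<le> t' + 1" "q \<le> m - t" "q \<le> m - t'"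
      using b unfolding p_def q_def by linarith+
    then have "(p, q) \<in> labels m" "label_endpoint (p, q) \<le> level_dist m t" "label_endpoint (p, q) \<le> level_dist m t'"
      using b(1,2) by (auto simp: labels_def label_endpoint_def endpoint_def level_dist_def)
    then show "x \<in> unit_index m"
      using b(1,2) by (simp add: x unit_index_def level_dist_le p_def q_def)
  qed
  ultimately show ?thesis by (rule card_inj_on_le) simp
qed

definition orbit_matrix :: "nat \<Rightarrow> nat \<times> nat \<times> nat \<times> nat \<Rightarrow> vmat" where
  "orbit_matrix m o' y z = of_bool (y \<in> odd_X m \<and> z \<in> odd_X m \<and> orbit_type m y z = o')"

lemma sum_fun_apply: "(\<Sum>i\<in>I. f i) x = (\<Sum>i\<in>I. f i x)"
  by (induction I rule: infinite_finite_induct) simp_all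

lemma terwilliger_orbit_sum:
  assumes "M \<in> terwilliger m"
  shows "\<exists>c. M = (\<Sum>o'\<in>orbit_types m. (\<lambda>y z. c o' * orbit_matrix m o' y z))"
proof -
  have "\<forall>o'\<in>orbit_types m. \<exists>k. \<forall>y\<in>odd_X m. \<forall>z\<in>odd_X m. orbit_type m y z = o' \<longrightarrow> M y z = k"
  proof
    fix o' assume "o' \<in> orbit_types m"
    then obtain y z where yz: "y \<in> odd_X m" "z \<in> odd_X m" "orbit_type m y z = o'"
      by (auto simp: orbit_types_def)
    have "M y' z' = M y z" if y'z': "y' \<in> odd_X m" "z' \<in> odd_X m" "orbit_type m y' z' = o'" for y' z'
    proof -
      obtain \<pi> where \<pi>: "\<pi> permutes ground m" "\<pi> ` base_x0 m = base_x0 m" "\<pi> ` y = y'" "\<pi> ` z = z'"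
        using orbit_transitive[OF yz(1,2) y'z'(1,2)] yz(3) y'z'(3) by metis
      then show ?thesis using terwilliger_invariant[OF assms \<pi>(1,2), of y z] by simp
    qed
    then show "\<exists>k. \<forall>y\<in>odd_X m. \<forall>z\<in>odd_X m. orbit_type m y z = o' \<longrightarrow> M y z = k" by blast
  qed
  then obtain c where c: "\<And>y z. y \<in> odd_X m \<Longrightarrow> z \<in> odd_X m \<Longrightarrow> orbit_type m y z \<in> orbit_types m
      \<Longrightarrow> M y z = c (orbit_type m y z)"
    by metis
  have "M y z = (\<Sum>o'\<in>orbit_types m. c o' * orbit_matrix m o' y z)" for y z
  proof (cases "y \<in> odd_X m \<and> z \<in> odd_X m")
    case True
    then have mem: "orbit_type m y z \<in> orbit_types m" by (auto simp: orbit_types_def)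
    have "(\<Sum>o'\<in>orbit_types m. c o' * orbit_matrix m o' y z)
        = (\<Sum>o'\<in>orbit_types m. if o' = orbit_type m y z then c (orbit_type m y z) else 0)"
      using True by (intro sum.cong) (auto simp: orbit_matrix_def)
    then show ?thesis using True mem c by (simp add: orbit_types_def)
  next
    case False
    then show ?thesis using terwilliger_outside[OF assms] by (auto simp: orbit_matrix_def)
  qed
  then show ?thesis by (intro exI[of _ c] ext) (simp add: sum_fun_apply)
qed

text \<open>\<open>rep\<close> supplies functionals dual to the matrix units, and the orbit
  matrices, which are no more numerous, span a space containing T.\<close>

lemma terwilliger_expansion:
  assumes "M \<in> terwilliger m"
    and \<tau>: "\<And>l a b. (l, a, b) \<in> unit_index m \<Longrightarrow> acts_as m (\<tau> (l, a, b)) a b (\<lambda>l'. of_bool (l' = l))"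
  shows "M y z = (\<Sum>u\<in>unit_index m. rep m (fst u) M (fst (snd u)) (snd (snd u)) * \<tau> u y z)"
proof -
  interpret vs: vector_space "\<lambda>c (M :: vmat) x y. c * M x y"
    by unfold_locales (auto simp: fun_eq_iff algebra_simps)
  let ?B = "orbit_matrix m ` orbit_types m"
  have fin: "finite (orbit_types m)" by (simp add: orbit_types_def)
  have sp: "N \<in> vs.span ?B" if N: "N \<in> terwilliger m" for N
  proof -
    obtain c where "N = (\<Sum>o'\<in>orbit_types m. (\<lambda>y z. c o' * orbit_matrix m o' y z))"
      using terwilliger_orbit_sum[OF N] by blast
    moreover have "(\<lambda>y z. c o' * orbit_matrix m o' y z) \<in> vs.span ?B" if "o' \<in> orbit_types m" for o'
      using vs.span_scale[OF vs.span_base[of "orbit_matrix m o'" ?B]] that by blast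
    ultimately show ?thesis by (simp add: vs.span_sum)
  qed
  have "M = (\<Sum>u\<in>unit_index m. (\<lambda>x y. rep m (fst u) M (fst (snd u)) (snd (snd u)) * \<tau> u x y))"
  proof (rule vs.biorthogonal_expansion[where B = ?B])
    show "card ?B \<le> card (unit_index m)"
      using card_image_le[OF fin, of "orbit_matrix m"] card_orbit_types_le[of m] by linarith
    show "\<tau> u \<in> vs.span ?B" if "u \<in> unit_index m" for u
      using that \<tau>[of "fst u" "fst (snd u)" "snd (snd u)"] sp by (simp add: acts_as_def)
    show "rep m (fst u) (A + B) (fst (snd u)) (snd (snd u)) = rep m (fst u) A (fst (snd u)) (snd (snd u))
        + rep m (fst u) B (fst (snd u)) (snd (snd u))" for u A B
      using rep_add[of m _ A B] by (simp add: plus_fun_def)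
    show "rep m (fst u) (\<tau> v) (fst (snd u)) (snd (snd u)) = (if u = v then 1 else 0)"
      if "u \<in> unit_index m" "v \<in> unit_index m" for u v
    proof -
      obtain l a b where u: "u = (l, a, b)" by (rule prod_cases3)
      obtain l' a' b' where v: "v = (l', a', b')" by (rule prod_cases3)
      have "l \<in> labels m" "a \<le> m" using that(1) by (simp_all add: u unit_index_def)
      then show ?thesis using \<tau>[OF that(2)[unfolded v]] unfolding u v acts_as_def by simp
    qed
  qed (use fin sp assms(1) in \<open>simp_all add: rep_smult\<close>)
  from this[THEN fun_cong, THEN fun_cong, of y z] show ?thesis by (simp add: sum_fun_apply)
qed

section \<open>The isomorphism\<close>

text \<open>The solutions of \<open>endpoint p q = m - d\<close>. Its parity decides whether 2p or
  2q - 1 attains the maximum; the other coordinate runs over 0..(m - d) div 2 and is always the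
  smaller one, hence recovered as \<open>min p q\<close>.\<close>

definition block_label :: "nat \<Rightarrow> nat \<Rightarrow> nat \<Rightarrow> nat \<times> nat" where
  "block_label m d k = (if even (m - d) then ((m - d) div 2, k) else (k, (m - d + 1) div 2))"

lemma block_label:
  assumes "d \<le> m" and "k < blk_mult m d"
  shows "block_label m d k \<in> labels m" "label_endpoint (block_label m d k) = m - d"
    "min (fst (block_label m d k)) (snd (block_label m d k)) = k"
proof -
  define r where "r = m - d"
  have r: "r \<le> m" "k < r - (r + 1) div 2 + 1" using assms by (simp_all add: r_def blk_mult_def)
  have "block_label m d k \<in> labels m \<and> label_endpoint (block_label m d k) = r
    \<and> min (fst (block_label m d k)) (snd (block_label m d k)) = k"
  proof (cases "even r")
    case True
    then obtain h where "r = 2 * h" by (rule evenE)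
    then show ?thesis using r
      by (simp add: block_label_def r_def[symmetric] labels_def label_endpoint_def endpoint_def)
  next
    case False
    then obtain h where "r = 2 * h + 1" by (rule oddE)
    then show ?thesis using r
      by (simp add: block_label_def r_def[symmetric] labels_def label_endpoint_def endpoint_def)
  qed
  then show "block_label m d k \<in> labels m" "label_endpoint (block_label m d k) = m - d"
    "min (fst (block_label m d k)) (snd (block_label m d k)) = k" by (simp_all add: r_def)
qed

lemma label_block:
  assumes "l \<in> labels m"
  shows "block_label m (m - label_endpoint l) (min (fst l) (snd l)) = l"
    "min (fst l) (snd l) < blk_mult m (m - label_endpoint l)"
proof -
  obtain p q where l: "l = (p, q)" by fastforce
  have r: "m - (m - label_endpoint l) = label_endpoint l" using label_endpoint_le[OF assms] by simp
  have "block_label m (m - label_endpoint l) (min p q) = l \<and> min p q < blk_mult m (m - label_endpoint l)"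
  proof (cases "q \<le> p")
    case True
    then have "label_endpoint l = 2 * p" by (simp add: l label_endpoint_def endpoint_def)
    then show ?thesis using True r by (simp add: block_label_def blk_mult_def l)
  next
    case False
    then obtain q' where q': "q = Suc q'" by (cases q) auto
    then have "label_endpoint l = 2 * q' + 1" using False by (simp add: l label_endpoint_def endpoint_def)
    then show ?thesis using False r q' by (simp add: block_label_def blk_mult_def l)
  qed
  then show "block_label m (m - label_endpoint l) (min (fst l) (snd l)) = l"
    "min (fst l) (snd l) < blk_mult m (m - label_endpoint l)" by (simp_all add: l)
qed

text \<open>Row i of a block of size d + 1 corresponds to the distance m - i.\<close>
definition blocks :: "nat \<Rightarrow> vmat \<Rightarrow> dsum" where
  "blocks m M = (\<lambda>d k i j. if ds_in m d k i j then rep m (block_label m d k) M (m - i) (m - j) else 0)"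

lemma blocks_eq_rep:
  assumes "(l, a, b) \<in> unit_index m"
  shows "blocks m M (m - label_endpoint l) (min (fst l) (snd l)) (m - a) (m - b) = rep m l M a b"
  using assms label_block[of l m] by (auto simp: blocks_def ds_in_def unit_index_def)

lemma blocks_mult:
  assumes "N \<in> terwilliger m"
  shows "blocks m (vmat_mult m M N) = ds_mult m (blocks m M) (blocks m N)"
proof (intro ext)
  fix d k i j
  show "blocks m (vmat_mult m M N) d k i j = ds_mult m (blocks m M) (blocks m N) d k i j"
  proof (cases "ds_in m d k i j")
    case True
    then have dk: "d \<le> m" "k < blk_mult m d" by (auto simp: ds_in_def)
    let ?l = "block_label m d k"
    let ?g = "\<lambda>n. rep m ?l M (m - i) n * rep m ?l N n (m - j)"
    \<comment> \<open>Distances below the endpoint m - d contribute nothing; the remaining d + 1 are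
      reversed to match the row convention of \<open>blocks\<close>.\<close>
    have "(\<Sum>n\<le>m. ?g n) = (\<Sum>n\<in>{m - d..m}. ?g n)"
      using rep_zero[OF block_label(1)[OF dk]] block_label(2)[OF dk]
      by (intro sum.mono_neutral_right) auto
    also have "\<dots> = (\<Sum>n\<le>d. ?g (m - n))"
      by (rule sum.reindex_bij_witness[of _ "\<lambda>n. m - n" "\<lambda>n. m - n"]) (use dk in auto)
    finally show ?thesis using True assms block_label(1)[OF dk]
      by (auto simp: blocks_def ds_mult_def rep_mult ds_in_def intro!: sum.cong)
  qed (auto simp: blocks_def ds_mult_def)
qed

lemma blocks_one: "blocks m (vmat_one m) = ds_one m"
proof (intro ext)
  fix d k i j
  show "blocks m (vmat_one m) d k i j = ds_one m d k i j"
  proof (cases "ds_in m d k i j")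
    case True
    then have dk: "d \<le> m" "k < blk_mult m d" and ij: "i \<le> d" "j \<le> d" by (auto simp: ds_in_def)
    let ?l = "block_label m d k" and ?y = "test_vertex m (m - i)"
    have y: "?y \<in> odd_X m" "vdist m ?y = m - i" by (simp_all add: test_vertex)
    have "rep m ?l (vmat_one m) (m - i) (m - j)
        = (\<Sum>z\<in>odd_X m. if z = ?y then module_vec m ?l (m - j) ?y else 0)"
      unfolding rep_def by (intro sum.cong) (auto simp: vmat_one_def y)
    also have "\<dots> = of_bool (i = j)"
    proof -
      have "specht m (fst ?l) (snd ?l) ?y = 1"
        using specht_test_vertex[of "fst ?l" "snd ?l" m "m - i"] block_label(1,2)[OF dk] dk ij
        by (simp add: label_endpoint_def)
      moreover have "m - i = m - j \<longleftrightarrow> i = j" using dk ij by auto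
      ultimately show ?thesis by (simp add: y module_vec_def)
    qed
    finally show ?thesis using True by (simp add: blocks_def ds_one_def)
  qed (auto simp: blocks_def ds_one_def)
qed

lemma terwilliger_sum:
  assumes "\<And>u. u \<in> I \<Longrightarrow> \<tau> u \<in> terwilliger m"
  shows "(\<lambda>y z. \<Sum>u\<in>I. c u * \<tau> u y z) \<in> terwilliger m"
  using assms
proof (induction I rule: infinite_finite_induct)
  case (insert u I)
  then show ?case using terwilliger.add[OF terwilliger.smult[of "\<tau> u" m "c u"]] by simp
\<comment> \<open>The empty sum is obtained as 0 times \<open>A1 m\<close>.\<close>
qed (use terwilliger.smult[OF terwilliger.gen_A, of 0] in simp_all)

lemma rep_sum:
  "rep m l (\<lambda>y z. \<Sum>u\<in>I. c u * \<tau> u y z) i j = (\<Sum>u\<in>I. c u * rep m l (\<tau> u) i j)"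
  unfolding rep_def sum_distrib_left sum_distrib_right by (subst sum.swap) (simp add: mult.assoc)

text \<open>The entries of \<open>blocks m M\<close> are exactly the coefficients in
  \<open>terwilliger_expansion\<close>, which gives injectivity; combining matrix units with
  prescribed coefficients gives surjectivity.\<close>

lemma blocks_bij:
  assumes "m \<ge> 2"
  shows "bij_betw (blocks m) (terwilliger m) (ds_carrier m)"
proof -
  have "\<forall>u\<in>unit_index m. \<exists>M. acts_as m M (fst (snd u)) (snd (snd u)) (\<lambda>l. of_bool (l = fst u))"
    using matrix_unit assms by (auto simp: unit_index_def)
  then obtain \<tau> where "\<forall>u\<in>unit_index m. acts_as m (\<tau> u) (fst (snd u)) (snd (snd u)) (\<lambda>l. of_bool (l = fst u))"
    by metis
  then have \<tau>: "\<And>l a b. (l, a, b) \<in> unit_index m \<Longrightarrow> acts_as m (\<tau> (l, a, b)) a b (\<lambda>l'. of_bool (l' = l))"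
    by fastforce
  show ?thesis
    unfolding bij_betw_def
  proof (intro conjI equalityI subsetI)
    show "inj_on (blocks m) (terwilliger m)"
    proof (intro inj_onI ext)
      fix M N y z assume MN: "M \<in> terwilliger m" "N \<in> terwilliger m" "blocks m M = blocks m N"
      have "rep m (fst u) M (fst (snd u)) (snd (snd u)) = rep m (fst u) N (fst (snd u)) (snd (snd u))"
        if "u \<in> unit_index m" for u
        using that MN(3) blocks_eq_rep[of "fst u" "fst (snd u)" "snd (snd u)" m]
        by (metis prod.collapse)
      then show "M y z = N y z"
        using terwilliger_expansion[OF MN(1) \<tau>] terwilliger_expansion[OF MN(2) \<tau>] by simp
    qed
  next
    fix B assume "B \<in> blocks m ` terwilliger m"
    then show "B \<in> ds_carrier m"
      by (auto simp: blocks_def ds_carrier_def ds_in_def split: if_splits)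
  next
    fix B assume B: "B \<in> ds_carrier m"
    define c where "c = (\<lambda>(l, a, b). B (m - label_endpoint l) (min (fst l) (snd l)) (m - a) (m - b))"
    define M where "M = (\<lambda>y z. \<Sum>u\<in>unit_index m. c u * \<tau> u y z)"
    have "M \<in> terwilliger m"
      unfolding M_def using \<tau> by (intro terwilliger_sum) (auto simp: acts_as_def)
    moreover have "blocks m M d k i j = B d k i j" for d k i j
    proof (cases "ds_in m d k i j")
      case True
      then have dk: "d \<le> m" "k < blk_mult m d" and ij: "i \<le> d" "j \<le> d" by (auto simp: ds_in_def)
      let ?l = "block_label m d k"
      let ?u = "(?l, m - i, m - j)"
      have u: "?u \<in> unit_index m"
        using block_label[OF dk] dk ij by (auto simp: unit_index_def)
      have "rep m ?l M (m - i) (m - j)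
          = (\<Sum>v\<in>unit_index m. c v * rep m ?l (\<tau> v) (m - i) (m - j))"
        unfolding M_def by (rule rep_sum)
      also have "\<dots> = (\<Sum>v\<in>unit_index m. if v = ?u then c ?u else 0)"
      proof (intro sum.cong refl)
        fix v assume "v \<in> unit_index m"
        moreover obtain l a b where v: "v = (l, a, b)" by (rule prod_cases3)
        ultimately have "acts_as m (\<tau> v) a b (\<lambda>l'. of_bool (l' = l))" using \<tau> by blast
        then show "c v * rep m ?l (\<tau> v) (m - i) (m - j) = (if v = ?u then c ?u else 0)"
          using block_label(1)[OF dk] by (auto simp: acts_as_def v)
      qed
      also have "\<dots> = B d k i j"
        using u block_label[OF dk] dk ij by (simp add: c_def)
      finally show ?thesis using True by (simp add: blocks_def)
    next
      case False
      then show ?thesis using B by (auto simp: blocks_def ds_carrier_def ds_in_def)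
    qed
    then have "blocks m M = B" by (intro ext)
    ultimately show "B \<in> blocks m ` terwilliger m" by blast
  qed
qed

theorem theorem4p3:
  fixes m :: nat
  assumes "m \<ge> 3"
  shows "\<exists>\<phi> :: vmat \<Rightarrow> dsum.
     bij_betw \<phi> (terwilliger m) (ds_carrier m) \<and>
     (\<forall>A\<in>terwilliger m. \<forall>B\<in>terwilliger m.
        \<phi> (\<lambda>x y. A x y + B x y) = (\<lambda>d k i j. \<phi> A d k i j + \<phi> B d k i j) \<and>
        \<phi> (vmat_mult m A B) = ds_mult m (\<phi> A) (\<phi> B)) \<and>
     (\<forall>A\<in>terwilliger m. \<forall>c::complex.
        \<phi> (\<lambda>x y. c * A x y) = (\<lambda>d k i j. c * \<phi> A d k i j)) \<and>
     \<phi> (vmat_one m) = ds_one m"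
proof (intro exI[of _ "blocks m"] conjI ballI allI)
  show "bij_betw (blocks m) (terwilliger m) (ds_carrier m)" using blocks_bij assms by simp
  fix A B c
  show "blocks m (\<lambda>x y. A x y + B x y) = (\<lambda>d k i j. blocks m A d k i j + blocks m B d k i j)"
    by (auto simp: blocks_def rep_add fun_eq_iff)
  show "blocks m (\<lambda>x y. c * A x y) = (\<lambda>d k i j. c * blocks m A d k i j)"
    by (auto simp: blocks_def rep_smult fun_eq_iff)
  show "blocks m (vmat_mult m A B) = ds_mult m (blocks m A) (blocks m B)" if "B \<in> terwilliger m"
    using blocks_mult[OF that] .
qed (rule blocks_one)

end
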